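(* Let $d\equiv 2\pmod 4$ and $\alpha>0$. There is a constant $\beta=\beta(\alpha)>0$ (depending only on $\alpha$ and $d$) such that for every $n$ and every two $n$-tuples $P,P'\in(\mathbb{R}^d)^n$ that are both $\alpha$-non-elongated, both in general position, and have the same order type, \[ \operatorname{dist}(P,P')\leq \left(\frac{d}{2}-\beta\right)\binom{n}{d+1}. \]
   Context: An $n$-tuple $P$ of points in $\mathbb{R}^d$ is $\alpha$-non-elongated if the ratio between the largest and the smallest distance between (distinct-index) points of $P$ is at most $\alpha\, n^{1/d}$. For points $p_0,\dots,p_d\in\mathbb{R}^d$, their orientation is the sign of the $(d+1)\times(d+1)$ determinant whose first row is all $1$'s and whose columns below it are the coordinates of $p_0,\dots,p_d$. The order type of $P=(p_1,\dots,p_n)$ is the function assigning to each $(d+1)$-element index set $i_0<\dots<i_d$ the orientation of $(p_{i_0},\dots,p_{i_d})$. A tuple is in general position if no $d+1$ of its points lie on a common hyperplane. A motion between $P,P'$ is a continuous $m\colon[0,1]\to(\mathbb{R}^d)^n$ with $m(0)=P$, $m(1)=P'$, such that $m(t)$ fails to be in general position for only finitely many $t$, and at each such $t$ exactly one set of $d+1$ points of $m(t)$ lies on a common hyperplane; its cost is the number of such times. $\operatorname{dist}(P,P')$ is the minimum cost of a motion from $P$ to $P'$. *)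

theory Defs
  imports "HOL-Analysis.Analysis"
begin

(* An n-tuple is a function on nat of which only the values at indices below n matter.
   The dimension is CARD('d); the linear order on 'd numbers the coordinates, as the sign
   of an orientation requires. *)

definition index_sets :: "nat \<Rightarrow> nat \<Rightarrow> nat set set" where
  "index_sets d n = {I. I \<subseteq> {..<n} \<and> card I = d + 1}"

definition pairwise_dists :: "nat \<Rightarrow> (nat \<Rightarrow> real ^ 'd) \<Rightarrow> real set" where
  "pairwise_dists n P = {dist (P i) (P j) | i j. i < n \<and> j < n \<and> i \<noteq> j}"

(* Injectivity makes the ratio meaningful (in HOL x / 0 = 0); it follows from general
   position once n > CARD('d). With fewer than two points there is no ratio to bound. *)
definition non_elongated :: "real \<Rightarrow> nat \<Rightarrow> (nat \<Rightarrow> real ^ 'd) \<Rightarrow> bool" where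
  "non_elongated \<alpha> n P \<longleftrightarrow> inj_on P {..<n} \<and>
     (2 \<le> n \<longrightarrow> Max (pairwise_dists n P) / Min (pairwise_dists n P)
                 \<le> \<alpha> * real n powr (1 / real CARD('d)))"

(* 'd option indexes the rows and columns of the bordered matrix, with None in position 0. *)
fun position :: "'d::{finite,linorder} option \<Rightarrow> nat" where
  "position None = 0"
| "position (Some k) = Suc (card {j. j < k})"

definition orientation :: "(nat \<Rightarrow> real ^ 'd::{finite,linorder}) \<Rightarrow> real" where
  "orientation p = sgn (det ((\<chi> r c. case r of None \<Rightarrow> 1 | Some k \<Rightarrow> p (position c) $ k)
                             :: real ^ 'd option ^ 'd option))"

definition order_type :: "nat \<Rightarrow> (nat \<Rightarrow> real ^ 'd::{finite,linorder}) \<Rightarrow> nat set \<Rightarrow> real" where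
  "order_type n P = (\<lambda>I\<in>index_sets CARD('d) n. orientation (\<lambda>k. P (sorted_list_of_set I ! k)))"

definition on_common_hyperplane :: "(real ^ 'd) set \<Rightarrow> bool" where
  "on_common_hyperplane S \<longleftrightarrow> (\<exists>a b. a \<noteq> 0 \<and> S \<subseteq> {x. a \<bullet> x = b})"

definition general_position :: "nat \<Rightarrow> (nat \<Rightarrow> real ^ 'd) \<Rightarrow> bool" where
  "general_position n P \<longleftrightarrow> (\<forall>I\<in>index_sets CARD('d) n. \<not> on_common_hyperplane (P ` I))"

definition degenerate_times :: "nat \<Rightarrow> (real \<Rightarrow> nat \<Rightarrow> real ^ 'd) \<Rightarrow> real set" where
  "degenerate_times n m = {t \<in> {0..1}. \<not> general_position n (m t)}"

definition is_motion ::
  "nat \<Rightarrow> (nat \<Rightarrow> real ^ 'd) \<Rightarrow> (nat \<Rightarrow> real ^ 'd) \<Rightarrow> (real \<Rightarrow> nat \<Rightarrow> real ^ 'd) \<Rightarrow> bool" where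
  "is_motion n P P' m \<longleftrightarrow>
     (\<forall>i<n. continuous_on {0..1} (\<lambda>t. m t i)) \<and>
     (\<forall>i<n. m 0 i = P i) \<and> (\<forall>i<n. m 1 i = P' i) \<and>
     finite (degenerate_times n m) \<and>
     (\<forall>t\<in>degenerate_times n m. \<exists>!I. I \<in> index_sets CARD('d) n \<and> on_common_hyperplane (m t ` I))"

(* Taken in enat, so that the value would be infinity (not 0) if there were no motion;
   a nonempty infimum in enat is attained. *)
definition motion_dist :: "nat \<Rightarrow> (nat \<Rightarrow> real ^ 'd) \<Rightarrow> (nat \<Rightarrow> real ^ 'd) \<Rightarrow> enat" where
  "motion_dist n P P' = (INF m \<in> {m. is_motion n P P' m}. enat (card (degenerate_times n m)))"

end

theory Submission imports Defs begin

text \<open>Move \<open>P\<close> in a straight line to a target that is an affine image of \<open>P'\<close>. A tuple of \<open>d + 1\<close>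
  points degenerates at the roots of a polynomial of degree \<open>d\<close>. Orientation preserving affine maps
  cost nothing, and as \<open>d\<close> is even both \<open>R P'\<close> and \<open>- R P'\<close> are admissible targets. The two motions
  see the positive and the negative roots of the same polynomial \<open>det (P + s R P')\<close>, so the better one
  has at most \<open>d / 2\<close> events per tuple.

  The gain \<open>\<beta>\<close> comes from nonreal roots. If for some tuple all roots were real for every rotation
  \<open>R\<^sub>\<theta> = cos \<theta> + J sin \<theta>\<close> with \<open>J\<^sup>2 = -1\<close>, the number of positive roots would be constant in
  \<open>\<theta>\<close> and go to its complement from \<open>\<theta> = 0\<close> to \<open>\<theta> = pi\<close>, hence be the odd number \<open>d / 2\<close>; but it is even
  because the order types agree. By compactness finitely many angles produce nonreal roots for all
  tuples that are uniformly fat in \<open>P\<close> and in \<open>P'\<close>. Non-elongated point sets have few points in any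
  thin slab, so a positive fraction of the tuples is fat, and one of the angles serves a
  positive fraction of these. A small perturbation of the target makes the motion generic.\<close>

subsection \<open>Bordered determinants\<close>

text \<open>The condition modulo 4 enters only through \<open>\<i> ^ d = -1\<close>; evenness alone
  gives the complex structure \<open>J\<close>, hence a path of invertible linear maps from the
  identity to its negative. The certificate for a nonreal root is an inequality between continuous
  functions rather than a statement about roots. It is therefore open without any appeal to
  continuity of roots, and survives both the compactness argument and the perturbation of the
  target. Compactness needs bounded tuples whose determinants stay away from 0 uniformly in n; hence
  point sets are scaled to diameter 1 and fatness is measured by a threshold independent of n. For
  small n the slab estimate says nothing. There a single tuple with a nonreal root is enough,
  because the number of tuples is bounded.\<close>

lemma sum_UNIV_option:
  "(\<Sum>r\<in>UNIV. f r) = f None + (\<Sum>k\<in>UNIV. f (Some k))"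
  for f :: "'d::finite option \<Rightarrow> 'a::comm_monoid_add"
  by (simp add: UNIV_option_conv sum.reindex)

lemma prod_UNIV_option:
  "(\<Prod>r\<in>UNIV. f r) = f None * (\<Prod>k\<in>UNIV. f (Some k))"
  for f :: "'d::finite option \<Rightarrow> 'a::comm_monoid_mult"
  by (simp add: UNIV_option_conv prod.reindex)

text \<open>Stated over any commutative ring, because the determinant is later evaluated at complex
  points.\<close>

definition border :: "('d::finite option \<Rightarrow> 'a::comm_ring_1^'d) \<Rightarrow> 'a^'d option^'d option" where
  "border x = (\<chi> r c. case r of None \<Rightarrow> 1 | Some k \<Rightarrow> x c $ k)"

definition bdet :: "('d::finite option \<Rightarrow> 'a::comm_ring_1^'d) \<Rightarrow> 'a" where
  "bdet x = det (border x)"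

lemma border_nth [simp]:
  "border x $ None $ c = 1" "border x $ Some k $ c = x c $ k"
  by (simp_all add: border_def)

lemma orientation_eq_sgn_bdet: "orientation p = sgn (bdet (\<lambda>c. p (position c)))"
  by (simp add: orientation_def bdet_def border_def)

text \<open>A kernel vector of the transposed matrix is \<open>(- b, a)\<close> for a hyperplane
  \<open>a \<bullet> x = b\<close> through all the points. With \<open>a = 0\<close> the equations
  would force \<open>b = 0\<close> as well.\<close>

lemma bdet_eq_0_iff: "bdet x = 0 \<longleftrightarrow> on_common_hyperplane (range x)"
  for x :: "'d::finite option \<Rightarrow> real^'d"
proof -
  have mv: "(transpose (border x) *v v) $ c = v $ None + (\<chi> k. v $ Some k) \<bullet> x c"
    for v :: "real^'d option" and c
    by (simp add: matrix_vector_mult_def transpose_def sum_UNIV_option inner_vec_def mult.commute)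
  have "bdet x = 0 \<longleftrightarrow> det (transpose (border x)) = 0"
    by (simp add: bdet_def)
  also have "\<dots> \<longleftrightarrow> (\<exists>v. transpose (border x) *v v = 0 \<and> v \<noteq> 0)"
    using invertible_det_nz[of "transpose (border x)"] invertible_left_inverse[of "transpose (border x)"]
      matrix_left_invertible_ker[of "transpose (border x)"] by auto
  also have "\<dots> \<longleftrightarrow> on_common_hyperplane (range x)"
  proof
    assume "\<exists>v. transpose (border x) *v v = 0 \<and> v \<noteq> 0"
    then obtain v where v: "transpose (border x) *v v = 0" "v \<noteq> 0" by blast
    have eq: "(\<chi> k. v $ Some k) \<bullet> x c = - v $ None" for c
      using mv[of v c] v(1) by simp
    have "(\<chi> k. v $ Some k) \<noteq> 0"
    proof
      assume 0: "(\<chi> k. v $ Some k) = 0"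
      have "v $ r = 0" for r
      proof (cases r)
        case None
        then show ?thesis using eq[of None] by (simp add: 0)
      next
        case (Some k)
        then show ?thesis using arg_cong[OF 0, of "\<lambda>w. w $ k"] by simp
      qed
      with v(2) show False by (simp add: vec_eq_iff)
    qed
    with eq show "on_common_hyperplane (range x)"
      unfolding on_common_hyperplane_def by blast
  next
    assume "on_common_hyperplane (range x)"
    then obtain a b where ab: "a \<noteq> 0" "\<And>c. a \<bullet> x c = b"
      unfolding on_common_hyperplane_def by blast
    let ?v = "(\<chi> r. case r of None \<Rightarrow> - b | Some k \<Rightarrow> a $ k) :: real^'d option"
    have "(\<chi> k. ?v $ Some k) = a" by (simp add: vec_eq_iff)
    then have "transpose (border x) *v ?v = 0"
      using ab(2) mv[of ?v] by (simp add: vec_eq_iff)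
    moreover have "?v \<noteq> 0"
    proof
      assume "?v = 0"
      then have "?v $ Some k = 0" for k by (metis zero_index)
      with ab(1) show False by (simp add: vec_eq_iff)
    qed
    ultimately show "\<exists>v. transpose (border x) *v v = 0 \<and> v \<noteq> 0" by blast
  qed
  finally show ?thesis .
qed

text \<open>The row of ones is not scaled, so the exponent is d and not d + 1.\<close>

lemma bdet_scale:
  fixes x :: "'d::finite option \<Rightarrow> 'a::comm_ring_1^'d"
  shows "bdet (\<lambda>c. s *s x c) = s ^ CARD('d) * bdet x"
proof -
  let ?c = "\<lambda>r::'d option. case r of None \<Rightarrow> 1 | Some k \<Rightarrow> s"
  have "border (\<lambda>c. s *s x c) = (\<chi> r. ?c r *s border x $ r)"
    by (auto simp: vec_eq_iff border_def split: option.split)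
  then have "bdet (\<lambda>c. s *s x c) = prod ?c UNIV * det (\<chi> r. border x $ r)"
    unfolding bdet_def by (simp only: det_rows_mul)
  then show ?thesis by (simp add: prod_UNIV_option bdet_def)
qed

lemma bdet_permute:
  assumes "p permutes UNIV"
  shows "bdet (x \<circ> p) = of_int (sign p) * bdet x"
proof -
  have "border (x \<circ> p) = (\<chi> r c. border x $ r $ p c)"
    by (auto simp: vec_eq_iff border_def split: option.split)
  then show ?thesis
    using det_permute_columns[OF assms, of "border x"] by (simp add: bdet_def)
qed

lemma bdet_expand:
  "bdet x = (\<Sum>p | p permutes UNIV. of_int (sign p) * (\<Prod>k\<in>UNIV. x (p (Some k)) $ k))"
  by (simp add: bdet_def det_def prod_UNIV_option)

lemma bdet_of_real:
  "bdet (\<lambda>c. \<chi> k. of_real (x c $ k)) = (of_real (bdet x) :: 'a::{real_algebra_1,comm_ring_1})"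
  by (simp add: bdet_expand)

lemma continuous_on_bdet [continuous_intros]:
  fixes f :: "'b::topological_space \<Rightarrow> 'd::finite option \<Rightarrow> 'a::{real_normed_algebra_1,comm_ring_1}^'d"
  assumes "\<And>c. continuous_on S (\<lambda>y. f y c)"
  shows "continuous_on S (\<lambda>y. bdet (f y))"
  unfolding bdet_expand by (intro continuous_intros assms)

lemma sgn_eq_if_nonzero_on_unit_interval:
  fixes f :: "real \<Rightarrow> real"
  assumes "continuous_on {0..1} f" "\<And>t. t \<in> {0..1} \<Longrightarrow> f t \<noteq> 0"
  shows "sgn (f 0) = sgn (f 1)"
proof -
  have c: "is_interval (f ` {0..1})"
    using assms(1) by (simp add: is_interval_connected_1 connected_continuous_image)
  have "f 0 \<in> f ` {0..1}" "f 1 \<in> f ` {0..1}" "0 \<notin> f ` {0..1}"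
    using assms(2) by force+
  then have "\<not> (f 0 \<le> 0 \<and> 0 \<le> f 1)" "\<not> (f 1 \<le> 0 \<and> 0 \<le> f 0)"
    using c unfolding is_interval_1 by blast+
  then show ?thesis by (auto simp: sgn_if)
qed

subsection \<open>Tuples of points and motions\<close>

lemma bij_betw_position:
  "bij_betw position (UNIV :: 'd::{finite,linorder} option set) {..CARD('d)}"
proof -
  have mono: "card {j. j < k} < card {j. j < l}" if "k < l" for k l :: 'd
    using that by (intro psubset_card_mono) auto
  have "x = y" if "position x = position y" for x y :: "'d option"
  proof (cases x; cases y)
    fix k l assume "x = Some k" "y = Some l"
    then show ?thesis using that mono[of k l] mono[of l k] by (cases k l rule: linorder_cases) auto
  qed (use that in auto)
  then have inj: "inj (position :: 'd option \<Rightarrow> nat)" by (rule injI)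
  have "position x \<le> CARD('d)" for x :: "'d option"
  proof (cases x)
    case (Some k)
    have "card {j. j < k} < CARD('d)" by (rule psubset_card_mono) auto
    with Some show ?thesis by simp
  qed simp
  then have "range (position :: 'd option \<Rightarrow> nat) \<subseteq> {..CARD('d)}" by auto
  then have "range (position :: 'd option \<Rightarrow> nat) = {..CARD('d)}"
    by (intro card_subset_eq) (simp_all add: card_image[OF inj])
  with inj show ?thesis by (simp add: bij_betw_def)
qed

definition idx :: "nat set \<Rightarrow> 'd::{finite,linorder} option \<Rightarrow> nat" where
  "idx I c = sorted_list_of_set I ! position c"

definition tdet :: "nat set \<Rightarrow> (nat \<Rightarrow> real^'d::{finite,linorder}) \<Rightarrow> real" where
  "tdet I X = bdet (\<lambda>c. X (idx I c))"

lemma finite_index_sets [simp]: "finite (index_sets d n)"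
  by (simp add: index_sets_def)

lemma card_index_sets: "card (index_sets d n) = n choose (d + 1)"
  using n_subsets[of "{..<n}" "d + 1"] by (simp add: index_sets_def)

lemma index_setsD:
  assumes "I \<in> index_sets d n"
  shows "finite I" "card I = d + 1" "\<And>i. i \<in> I \<Longrightarrow> i < n"
  using assms by (auto simp: index_sets_def intro: finite_subset)

lemma bij_betw_idx:
  fixes n :: nat
  assumes "I \<in> index_sets CARD('d::{finite,linorder}) n"
  shows "bij_betw (idx I) (UNIV :: 'd::{finite,linorder} option set) I"
proof -
  note I = index_setsD[OF assms]
  have "bij_betw ((!) (sorted_list_of_set I)) {..CARD('d)} I"
    by (rule bij_betw_nth) (use I in auto)
  moreover have "(idx I :: 'd option \<Rightarrow> nat) = (\<lambda>i. sorted_list_of_set I ! i) \<circ> position"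
    by (simp add: idx_def fun_eq_iff)
  ultimately show ?thesis
    using bij_betw_trans[OF bij_betw_position] by simp
qed

lemma idx_less:
  fixes c :: "'d::{finite,linorder} option"
  assumes "I \<in> index_sets CARD('d) n"
  shows "idx I c < n"
  using bij_betw_apply[OF bij_betw_idx[OF assms], of c] index_setsD(3)[OF assms] by simp

lemma tdet_cong:
  fixes X Y :: "nat \<Rightarrow> real^'d::{finite,linorder}"
  assumes "I \<in> index_sets CARD('d) n" "\<And>i. i < n \<Longrightarrow> X i = Y i"
  shows "tdet I X = tdet I Y"
  using assms by (simp add: tdet_def idx_less)

lemma continuous_on_tdet [continuous_intros]:
  fixes f :: "'b::topological_space \<Rightarrow> nat \<Rightarrow> real^'d::{finite,linorder}"
  assumes "I \<in> index_sets CARD('d) n" "\<And>i. i < n \<Longrightarrow> continuous_on S (\<lambda>y. f y i)"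
  shows "continuous_on S (\<lambda>y. tdet I (f y))"
  unfolding tdet_def by (intro continuous_intros assms(2) idx_less[OF assms(1)])

text \<open>The sign is that of the permutation between \<open>e\<close> and the increasing
  enumeration of \<open>I\<close>. It is the same for all tuples \<open>X\<close>, hence the order
  of the quantifiers.\<close>

lemma bdet_eq_tdet:
  fixes e :: "'d::{finite,linorder} option \<Rightarrow> nat"
  assumes "I \<in> index_sets CARD('d) n" "bij_betw e UNIV I"
  shows "\<exists>s\<in>{1,-1}. \<forall>X. bdet (\<lambda>c. X (e c)) = s * tdet I (X :: nat \<Rightarrow> real^'d::{finite,linorder})"
proof -
  let ?g = "inv_into UNIV (idx I :: 'd option \<Rightarrow> nat)"
  note b = bij_betw_idx[OF assms(1)]
  have "bij_betw (?g \<circ> e) UNIV UNIV"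
    using bij_betw_trans[OF assms(2) bij_betw_inv_into[OF b]] .
  then have p: "(?g \<circ> e) permutes UNIV" by (intro bij_imp_permutes) auto
  have "idx I ((?g \<circ> e) c) = e c" for c
    using b bij_betw_apply[OF assms(2), of c] by (simp add: bij_betw_def f_inv_into_f)
  then have eq: "(\<lambda>c. X (e c)) = (\<lambda>c. X (idx I c)) \<circ> (?g \<circ> e)" for X :: "nat \<Rightarrow> real^'d::{finite,linorder}"
    by (simp add: fun_eq_iff)
  have "bdet (\<lambda>c. X (e c)) = of_int (sign (?g \<circ> e)) * tdet I X" for X :: "nat \<Rightarrow> real^'d::{finite,linorder}"
    unfolding tdet_def eq by (rule bdet_permute[OF p])
  moreover have "of_int (sign (?g \<circ> e)) \<in> {1, -1::real}" by (simp add: sign_def)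
  ultimately show ?thesis by blast
qed

lemma on_common_hyperplane_iff_tdet:
  fixes X :: "nat \<Rightarrow> real^'d::{finite,linorder}"
  assumes "I \<in> index_sets CARD('d) n"
  shows "on_common_hyperplane (X ` I) \<longleftrightarrow> tdet I X = 0"
proof -
  have "X ` I = range (\<lambda>c::'d option. X (idx I c))"
    using bij_betw_imp_surj_on[OF bij_betw_idx[OF assms]] by (metis image_image)
  then show ?thesis by (simp add: tdet_def bdet_eq_0_iff)
qed

lemma general_position_iff_tdet:
  fixes X :: "nat \<Rightarrow> real^'d::{finite,linorder}"
  shows "general_position n X \<longleftrightarrow> (\<forall>I\<in>index_sets CARD('d) n. tdet I X \<noteq> 0)"
  by (simp add: general_position_def on_common_hyperplane_iff_tdet)

lemma general_position_cong:
  assumes "\<And>i. i < n \<Longrightarrow> X i = Y i"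
  shows "general_position n X \<longleftrightarrow> general_position n (Y :: nat \<Rightarrow> real^'d::{finite,linorder})"
  by (simp add: general_position_iff_tdet tdet_cong[OF _ assms])

lemma order_type_eqD:
  fixes P P' :: "nat \<Rightarrow> real^'d::{finite,linorder}"
  assumes "order_type n P = order_type n P'" "I \<in> index_sets CARD('d) n"
  shows "sgn (tdet I P) = sgn (tdet I P')"
  using fun_cong[OF assms(1), of I] assms(2)
  by (simp add: order_type_def orientation_eq_sgn_bdet tdet_def idx_def)

section \<open>Motions, reversal and concatenation\<close>

lemma motion_dist_le:
  "is_motion n P P' m \<Longrightarrow> motion_dist n P P' \<le> enat (card (degenerate_times n m))"
  unfolding motion_dist_def by (rule INF_lower) simp

text \<open>A motion of cost 0. Such motions preserve all orientations and can be attached to either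
  end of another motion without changing its cost.\<close>

definition free_motion :: "nat \<Rightarrow> (nat \<Rightarrow> real^'d) \<Rightarrow> (nat \<Rightarrow> real^'d) \<Rightarrow> bool" where
  "free_motion n P Q \<longleftrightarrow> (\<exists>m :: real \<Rightarrow> nat \<Rightarrow> real^'d.
     (\<forall>i<n. continuous_on {0..1} (\<lambda>t. m t i) \<and> m 0 i = P i \<and> m 1 i = Q i) \<and>
     (\<forall>t\<in>{0..1}. general_position n (m t)))"

lemma free_motionE:
  fixes P Q :: "nat \<Rightarrow> real^'d"
  assumes "free_motion n P Q"
  obtains m :: "real \<Rightarrow> nat \<Rightarrow> real^'d" where "\<And>i. i < n \<Longrightarrow> continuous_on {0..1} (\<lambda>t. m t i)"
      "\<And>i. i < n \<Longrightarrow> m 0 i = P i" "\<And>i. i < n \<Longrightarrow> m 1 i = Q i"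
      "\<And>t. t \<in> {0..1} \<Longrightarrow> general_position n (m t)"
proof -
  obtain m :: "real \<Rightarrow> nat \<Rightarrow> real^'d" where "\<forall>i<n. continuous_on {0..1} (\<lambda>t. m t i) \<and> m 0 i = P i \<and> m 1 i = Q i"
    "\<forall>t\<in>{0..1}. general_position n (m t)"
    using assms unfolding free_motion_def by blast
  then show thesis by (intro that[of m]) auto
qed

lemma free_motion_sgn_tdet:
  fixes P Q :: "nat \<Rightarrow> real^'d::{finite,linorder}"
  assumes "free_motion n P Q" "I \<in> index_sets CARD('d) n"
  shows "sgn (tdet I P) = sgn (tdet I Q)"
proof -
  obtain m :: "real \<Rightarrow> nat \<Rightarrow> real^'d::{finite,linorder}" where m: "\<And>i. i < n \<Longrightarrow> continuous_on {0..1} (\<lambda>t. m t i)"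
      "\<And>i. i < n \<Longrightarrow> m 0 i = P i" "\<And>i. i < n \<Longrightarrow> m 1 i = Q i"
      "\<And>t. t \<in> {0..1} \<Longrightarrow> general_position n (m t)"
    using free_motionE[OF assms(1)] by metis
  have "sgn (tdet I (m 0)) = sgn (tdet I (m 1))"
    using m(4) assms(2) 
    by (intro sgn_eq_if_nonzero_on_unit_interval continuous_on_tdet[OF assms(2)] m(1))
      (auto simp: general_position_iff_tdet)
  then show ?thesis
    using tdet_cong[OF assms(2), of "m 0" P] tdet_cong[OF assms(2), of "m 1" Q] m by simp
qed

lemma is_motion_reverse:
  assumes "is_motion n P Q m"
  shows "is_motion n Q P (\<lambda>t. m (1 - t))"
    and "card (degenerate_times n (\<lambda>t. m (1 - t))) = card (degenerate_times n m)"
proof -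
  have dt: "degenerate_times n (\<lambda>t. m (1 - t)) = (\<lambda>t. 1 - t) ` degenerate_times n m"
  proof (intro equalityI subsetI)
    fix t assume "t \<in> degenerate_times n (\<lambda>t. m (1 - t))"
    then have "1 - t \<in> degenerate_times n m" by (simp add: degenerate_times_def)
    then show "t \<in> (\<lambda>t. 1 - t) ` degenerate_times n m" by (rule rev_image_eqI) simp
  qed (auto simp: degenerate_times_def)
  then show "card (degenerate_times n (\<lambda>t. m (1 - t))) = card (degenerate_times n m)"
    by (simp add: card_image inj_on_def)
  have "continuous_on {0..1} (\<lambda>t. m (1 - t) i)" if "i < n" for i
    by (rule continuous_on_compose2[of "{0..1}" "\<lambda>t. m t i"])
      (use assms that in \<open>auto simp: is_motion_def intro!: continuous_intros\<close>)
  then show "is_motion n Q P (\<lambda>t. m (1 - t))"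
    using assms by (auto simp: is_motion_def dt)
qed

lemma is_motion_prepend:
  fixes P :: "nat \<Rightarrow> real^'d::{finite,linorder}"
  assumes "free_motion n P Q" "is_motion n Q R m"
  obtains m' where "is_motion n P R m'" "card (degenerate_times n m') = card (degenerate_times n m)"
proof -
  obtain f :: "real \<Rightarrow> nat \<Rightarrow> real^'d::{finite,linorder}" where f: "\<And>i. i < n \<Longrightarrow> continuous_on {0..1} (\<lambda>t. f t i)"
      "\<And>i. i < n \<Longrightarrow> f 0 i = P i" "\<And>i. i < n \<Longrightarrow> f 1 i = Q i"
      "\<And>t. t \<in> {0..1} \<Longrightarrow> general_position n (f t)"
    using free_motionE[OF assms(1)] by metis
  let ?h = "\<lambda>t. if t \<le> 1/2 then f (2 * t) else m (2 * t - 1)"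
  \<comment> \<open>The glued path follows \<open>f\<close> at the junction, so an event of
    \<open>m\<close> at time 0 would be lost. There is none, since \<open>m 0\<close> agrees with
    the final tuple of \<open>f\<close>.\<close>
  have m0: "general_position n (m 0)"
    using f(4)[of 1] general_position_cong[of n "m 0" "f 1"] f(3) assms(2) by (simp add: is_motion_def)
  have "t \<noteq> 0" if "t \<in> degenerate_times n m" for t
    using that m0 by (auto simp: degenerate_times_def)
  then have pos: "t > 0" if "t \<in> degenerate_times n m" for t
    using that by (force simp: degenerate_times_def)
  have dt: "degenerate_times n ?h = (\<lambda>t. (t + 1) / 2) ` degenerate_times n m"
  proof (intro equalityI subsetI)
    fix t assume t: "t \<in> degenerate_times n ?h"
    then have "t > 1/2" using f(4)[of "2 * t"] by (auto simp: degenerate_times_def split: if_splits)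
    with t have "2 * t - 1 \<in> degenerate_times n m" by (auto simp: degenerate_times_def)
    then show "t \<in> (\<lambda>t. (t + 1) / 2) ` degenerate_times n m" by (rule rev_image_eqI) simp
  next
    fix t assume "t \<in> (\<lambda>t. (t + 1) / 2) ` degenerate_times n m"
    then obtain u where u: "u \<in> degenerate_times n m" "t = (u + 1) / 2" by blast
    have "2 * t - 1 = u" "\<not> t \<le> 1/2" using pos[OF u(1)] u(2) by simp_all
    then have "?h t = m u" by simp
    with u show "t \<in> degenerate_times n ?h" by (auto simp: degenerate_times_def)
  qed
  have "is_motion n P R ?h"
    unfolding is_motion_def
  proof (intro conjI allI impI ballI)
    fix i assume i: "i < n"
    have "path ((\<lambda>t. f t i) +++ (\<lambda>t. m t i))"
      using f i assms(2) by (simp add: path_def is_motion_def pathstart_def pathfinish_def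
          flip: path_def)
    then show "continuous_on {0..1} (\<lambda>t. ?h t i)"
      by (simp add: path_def joinpaths_def if_distrib[of "\<lambda>g. g i"] cong: if_cong)
    show "?h 0 i = P i" "?h 1 i = R i"
      using f i assms(2) by (simp_all add: is_motion_def)
  next
    show "finite (degenerate_times n ?h)"
      unfolding dt using assms(2) by (simp add: is_motion_def)
  next
    fix t assume "t \<in> degenerate_times n ?h"
    then obtain u where u: "u \<in> degenerate_times n m" "t = (u + 1) / 2" unfolding dt by blast
    have "2 * t - 1 = u" "\<not> t \<le> 1/2" using pos[OF u(1)] u(2) by simp_all
    then have "?h t = m u" by simp
    then show "\<exists>!I. I \<in> index_sets CARD('d) n \<and> on_common_hyperplane (?h t ` I)"
      using u(1) assms(2) by (simp add: is_motion_def)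
  qed
  moreover have "card (degenerate_times n ?h) = card (degenerate_times n m)"
    unfolding dt by (rule card_image) (simp add: inj_on_def)
  ultimately show thesis by (rule that)
qed

lemma motion_dist_free_le:
  fixes P :: "nat \<Rightarrow> real^'d::{finite,linorder}"
  assumes "free_motion n P Q" "is_motion n Q Q' m" "free_motion n P' Q'"
  shows "motion_dist n P P' \<le> enat (card (degenerate_times n m))"
proof -
  obtain m1 where m1: "is_motion n P Q' m1" "card (degenerate_times n m1) = card (degenerate_times n m)"
    using is_motion_prepend[OF assms(1,2)] .
  \<comment> \<open>The piece at the far end is attached by reversing time, prepending, and
    reversing again.\<close>
  obtain m2 where m2: "is_motion n P' P m2" "card (degenerate_times n m2) = card (degenerate_times n m)"
    using is_motion_prepend[OF assms(3) is_motion_reverse(1)[OF m1(1)]] is_motion_reverse(2)[OF m1(1)] m1(2)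
    by metis
  show ?thesis
    using motion_dist_le[OF is_motion_reverse(1)[OF m2(1)]] is_motion_reverse(2)[OF m2(1)] m2(2) by simp
qed

lemma free_motion_trans:
  fixes P :: "nat \<Rightarrow> real^'d::{finite,linorder}"
  assumes "free_motion n P Q" "free_motion n Q R"
  shows "free_motion n P R"
proof -
  \<comment> \<open>Finiteness is part of \<open>is_motion\<close>, so cardinality 0 does mean that
    no time is degenerate.\<close>
  have eq: "free_motion n P Q \<longleftrightarrow> (\<exists>m. is_motion n P Q m \<and> card (degenerate_times n m) = 0)"
    for P Q :: "nat \<Rightarrow> real^'d::{finite,linorder}"
  proof
    assume "free_motion n P Q"
    then obtain m :: "real \<Rightarrow> nat \<Rightarrow> real^'d::{finite,linorder}" where m: "\<forall>i<n. continuous_on {0..1} (\<lambda>t. m t i) \<and> m 0 i = P i \<and> m 1 i = Q i"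
      "\<forall>t\<in>{0..1}. general_position n (m t)"
      unfolding free_motion_def by blast
    have "degenerate_times n m = {}" using m(2) by (auto simp: degenerate_times_def)
    then have "is_motion n P Q m \<and> card (degenerate_times n m) = 0"
      using m(1) by (auto simp: is_motion_def)
    then show "\<exists>m. is_motion n P Q m \<and> card (degenerate_times n m) = 0" by (rule exI[of _ m])
  next
    assume "\<exists>m. is_motion n P Q m \<and> card (degenerate_times n m) = 0"
    then obtain m where m: "is_motion n P Q m" "card (degenerate_times n m) = 0" by blast
    then have "degenerate_times n m = {}" by (simp add: is_motion_def)
    with m(1) show "free_motion n P Q"
      unfolding free_motion_def by (intro exI[of _ m]) (auto simp: is_motion_def degenerate_times_def)
  qed
  obtain m where "is_motion n Q R m" "card (degenerate_times n m) = 0"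
    using assms(2) eq by blast
  with is_motion_prepend[OF assms(1)] show ?thesis by (metis eq)
qed

subsection \<open>Real-rooted pencils and rotations\<close>

definition cpencil :: "('d::finite option \<Rightarrow> real^'d) \<Rightarrow> ('d option \<Rightarrow> real^'d) \<Rightarrow> complex \<Rightarrow> complex" where
  "cpencil x y z = bdet (\<lambda>c. \<chi> k. of_real (x c $ k) + z * of_real (y c $ k))"

text \<open>Where all roots of the pencil are real, its modulus at \<open>z\<close> is at least
  \<open>\<bar>bdet y\<bar> * \<bar>Im z\<bar> ^ d\<close>. Violating this bound therefore certifies a nonreal root, and it is
  visibly an open condition on \<open>x\<close> and \<open>y\<close>.\<close>

definition has_nonreal_root :: "('d::finite option \<Rightarrow> real^'d) \<Rightarrow> ('d option \<Rightarrow> real^'d) \<Rightarrow> bool" where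
  "has_nonreal_root x y \<longleftrightarrow> (\<exists>z. cmod (cpencil x y z) < \<bar>bdet y\<bar> * \<bar>Im z\<bar> ^ CARD('d))"

lemma cpencil_of_real: "cpencil x y (of_real s) = of_real (bdet (\<lambda>c. x c + s *\<^sub>R y c))"
  unfolding cpencil_def bdet_of_real[symmetric] by simp

section \<open>The pencil as a polynomial and its real roots\<close>

lemma degree_prod_linear_le: "degree (\<Prod>k\<in>A. [:a k, b k:]) \<le> card A"
  for a :: "'k \<Rightarrow> 'a::comm_ring_1"
proof (induction A rule: infinite_finite_induct)
  case (insert k A)
  have "degree ([:a k, b k:] * (\<Prod>k\<in>A. [:a k, b k:])) \<le> degree [:a k, b k:] + degree (\<Prod>k\<in>A. [:a k, b k:])"
    by (rule degree_mult_le)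
  also have "\<dots> \<le> 1 + card A" using insert.IH by (intro add_mono) (auto simp: degree_pCons_le)
  finally show ?case using insert.hyps by simp
qed auto

lemma coeff_prod_linear: "finite A \<Longrightarrow> coeff (\<Prod>k\<in>A. [:a k, b k:]) (card A) = (\<Prod>k\<in>A. b k)"
  for a :: "'k \<Rightarrow> 'a::comm_ring_1"
proof (induction A rule: finite_induct)
  case (insert k A)
  have "coeff (\<Prod>k\<in>A. [:a k, b k:]) (Suc (card A)) = 0"
    using degree_prod_linear_le[of a b A] by (intro coeff_eq_0) simp
  then show ?case using insert by simp
qed simp

text \<open>In the permutation expansion the row of ones contributes no factor in \<open>z\<close>
  and each of the other d rows a linear one; the top coefficients add up to
  \<open>bdet y\<close>.\<close>

lemma cpencil_poly:
  fixes x y :: "'d::finite option \<Rightarrow> real^'d"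
  obtains q where "degree q \<le> CARD('d)" "coeff q CARD('d) = of_real (bdet y)" "\<And>z. poly q z = cpencil x y z"
proof
  let ?P = "\<lambda>p. \<Prod>k\<in>UNIV. [:of_real (x (p (Some k)) $ k), of_real (y (p (Some k)) $ k) :: complex:]"
  let ?q = "\<Sum>p | p permutes (UNIV :: 'd option set). smult (of_int (sign p)) (?P p)"
  show "degree ?q \<le> CARD('d)"
    by (intro degree_sum_le order_trans[OF degree_smult_le degree_prod_linear_le]) auto
  show "coeff ?q CARD('d) = of_real (bdet y)"
    by (simp add: coeff_sum coeff_prod_linear bdet_expand)
  show "poly ?q z = cpencil x y z" for z
    by (simp add: poly_sum poly_prod bdet_expand cpencil_def)
qed

text \<open>As \<open>S\<close> has as many elements as the degree, it accounts for all linear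
  factors, and \<open>\<bar>Im z\<bar> \<le> cmod (z - s)\<close> for every real
  \<open>s\<close>.\<close>

lemma cmod_poly_ge_if_real_rooted:
  fixes q :: "complex poly" and S :: "real set"
  assumes "finite S" "card S = degree q" "q \<noteq> 0" "\<And>s. s \<in> S \<Longrightarrow> poly q (of_real s) = 0"
  shows "cmod (poly q z) \<ge> cmod (lead_coeff q) * \<bar>Im z\<bar> ^ degree q"
  using assms
proof (induction S arbitrary: q rule: finite_induct)
  case empty
  then obtain a where "q = [:a:]" by (auto elim: degree_eq_zeroE)
  then show ?case by simp
next
  case (insert s S)
  then have "[:- of_real s, 1:] dvd q" by (simp add: poly_eq_0_iff_dvd[symmetric])
  then obtain r where q: "q = [:- of_real s, 1:] * r" by (elim dvdE)
  with insert.prems have r: "r \<noteq> 0" by auto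
  then have deg: "degree q = Suc (degree r)" unfolding q by (subst degree_mult_eq) auto
  have "poly r (of_real u) = 0" if "u \<in> S" for u
    using insert.prems(3)[of u] insert.hyps(2) that by (auto simp: q)
  then have IH: "cmod (lead_coeff r) * \<bar>Im z\<bar> ^ degree r \<le> cmod (poly r z)"
    using insert deg r by (intro insert.IH) auto
  have "\<bar>Im z\<bar> \<le> cmod (z - of_real s)" using abs_Im_le_cmod[of "z - of_real s"] by simp
  then have "\<bar>Im z\<bar> * (cmod (lead_coeff r) * \<bar>Im z\<bar> ^ degree r) \<le> cmod (z - of_real s) * cmod (poly r z)"
    by (intro mult_mono IH) auto
  moreover have "lead_coeff q = lead_coeff r" unfolding q by (subst lead_coeff_mult) simp
  moreover have "cmod (poly q z) = cmod (z - of_real s) * cmod (poly r z)"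
    by (simp add: q norm_mult[symmetric] algebra_simps)
  ultimately show ?case by (simp add: deg mult_ac)
qed

lemma real_roots_bdet:
  fixes x y :: "'d::finite option \<Rightarrow> real^'d"
  defines "R \<equiv> {s. bdet (\<lambda>c. x c + s *\<^sub>R y c) = 0}"
  assumes "bdet x \<noteq> 0"
  shows "finite R" "card R \<le> CARD('d)" "has_nonreal_root x y \<Longrightarrow> card R < CARD('d)"
proof -
  obtain q where q: "degree q \<le> CARD('d)" "coeff q CARD('d) = of_real (bdet y)"
    "\<And>z. poly q z = cpencil x y z" by (rule cpencil_poly[where x=x and y=y]) blast
  have "poly q 0 \<noteq> 0" using assms(2) cpencil_of_real[of x y 0] by (simp add: q)
  then have q0: "q \<noteq> 0" by auto
  have root: "poly q (of_real s) = 0" if "s \<in> R" for s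
    using that by (simp add: q cpencil_of_real R_def)
  have sub: "complex_of_real ` R \<subseteq> {z. poly q z = 0}" using root by auto
  have inj: "inj_on complex_of_real R" by (simp add: inj_on_def)
  show fin: "finite R"
    using finite_subset[OF sub poly_roots_finite[OF q0]] inj by (simp add: finite_image_iff)
  have "card R \<le> card {z. poly q z = 0}"
    using card_mono[OF poly_roots_finite[OF q0] sub] by (simp add: card_image[OF inj])
  with card_poly_roots_bound[OF q0] have deg: "card R \<le> degree q" by linarith
  with q(1) show le: "card R \<le> CARD('d)" by simp
  assume "has_nonreal_root x y"
  then obtain z where z: "cmod (cpencil x y z) < \<bar>bdet y\<bar> * \<bar>Im z\<bar> ^ CARD('d)"
    by (auto simp: has_nonreal_root_def)
  show "card R < CARD('d)"
  proof (rule ccontr)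
    assume "\<not> card R < CARD('d)"
    \<comment> \<open>With d distinct real roots \<open>q\<close> has degree exactly d and leading
      coefficient \<open>bdet y\<close>, so the modulus bound would hold at
      \<open>z\<close>.\<close>
    with deg q(1) have d: "card R = degree q" "degree q = CARD('d)" by auto
    have "cmod (lead_coeff q) * \<bar>Im z\<bar> ^ degree q \<le> cmod (poly q z)"
      by (rule cmod_poly_ge_if_real_rooted[OF fin d(1) q0 root])
    with z show False by (simp add: d(2) q)
  qed
qed

text \<open>The difference of two continuous arguments of the same function takes values in the
  integer multiples of 2 pi, a discrete set.\<close>

lemma continuous_on_cis_eq:
  fixes f g :: "'a::topological_space \<Rightarrow> real"
  assumes "connected S" "continuous_on S f" "continuous_on S g" "\<And>x. x \<in> S \<Longrightarrow> cis (f x) = cis (g x)"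
    "a \<in> S" "b \<in> S"
  shows "f a - g a = f b - g b"
proof -
  have "(\<lambda>x. f x - g x) constant_on S"
  proof (rule continuous_discrete_range_constant[OF assms(1)])
    fix x assume x: "x \<in> S"
    have "2 * pi \<le> norm ((f y - g y) - (f x - g x))" if y: "y \<in> S" "f y - g y \<noteq> f x - g x" for y
    proof -
      have "\<exists>k::int. f w - g w = 2 * pi * of_int k" if "w \<in> S" for w
      proof -
        have "exp (\<i> * of_real (f w)) = exp (\<i> * of_real (g w))"
          using assms(4)[OF that] by (simp add: cis_conv_exp)
        then obtain k :: int where "\<i> * of_real (f w) = \<i> * of_real (g w) + of_int (2 * k) * pi * \<i>"
          unfolding exp_eq by blast
        then have "Im (\<i> * of_real (f w)) = Im (\<i> * of_real (g w) + of_int (2 * k) * pi * \<i>)" by simp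
        then show ?thesis by (intro exI[of _ k]) simp
      qed
      then obtain k l :: int where kl: "f x - g x = 2 * pi * k" "f y - g y = 2 * pi * l"
        using x y(1) by metis
      have eq: "(f y - g y) - (f x - g x) = 2 * pi * (of_int (l - k))"
        unfolding kl by (simp add: algebra_simps)
      have "l \<noteq> k" using y(2) kl by auto
      then have "\<bar>of_int (l - k) :: real\<bar> \<ge> 1"
        by linarith
      then show ?thesis unfolding eq by (simp add: abs_mult)
    qed
    then show "\<exists>e>0. \<forall>y. y \<in> S \<and> f y - g y \<noteq> f x - g x \<longrightarrow> e \<le> norm ((f y - g y) - (f x - g x))"
      by (intro exI[of _ "2 * pi"]) auto
  qed (intro continuous_intros assms)
  then show ?thesis using assms(5,6) by (auto simp: constant_on_def)
qed

section \<open>Affine images and rotations\<close>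

lemma on_common_hyperplane_affine_image:
  fixes L :: "real^'d \<Rightarrow> real^'d"
  assumes "linear L" "inj L" "on_common_hyperplane ((\<lambda>x. w + L x) ` S)"
  shows "on_common_hyperplane S"
proof -
  obtain a b where "a \<noteq> 0" and sub: "(\<lambda>x. w + L x) ` S \<subseteq> {x. a \<bullet> x = b}"
    using assms(3) unfolding on_common_hyperplane_def by (elim exE conjE)
  then have ab: "a \<noteq> 0" "\<And>x. x \<in> S \<Longrightarrow> a \<bullet> (w + L x) = b" by (auto dest: subsetD)
  have "surj L" by (rule linear_injective_imp_surjective[OF assms(1,2)]) simp
  \<comment> \<open>The adjoint pulls the normal \<open>a\<close> back to a vector whose inner
    product with \<open>u\<close> is \<open>a \<bullet> a\<close>, so it does not vanish.\<close>
  then obtain u where "a = L u" by (rule surjE)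
  then have "adjoint L a \<bullet> u \<noteq> 0" using ab(1) by (simp add: adjoint_clauses[OF assms(1)])
  then have "adjoint L a \<noteq> 0" by auto
  moreover have "adjoint L a \<bullet> x = b - a \<bullet> w" if "x \<in> S" for x
    using ab(2)[OF that] by (simp add: adjoint_clauses[OF assms(1)] inner_add_right)
  then have "S \<subseteq> {x. adjoint L a \<bullet> x = b - a \<bullet> w}" by auto
  ultimately show ?thesis unfolding on_common_hyperplane_def by (intro exI conjI)
qed

lemma bdet_affine_image_nonzero:
  fixes x :: "'d::finite option \<Rightarrow> real^'d" and L :: "real^'d \<Rightarrow> real^'d"
  assumes "linear L" "inj L" "bdet x \<noteq> 0"
  shows "bdet (\<lambda>c. w + L (x c)) \<noteq> 0"
  using assms on_common_hyperplane_affine_image[OF assms(1,2), of w "range x"]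
  by (auto simp: bdet_eq_0_iff image_image)

text \<open>When \<open>J (J v) = - v\<close>, this is multiplication by
  \<open>exp (\<i> * \<theta>)\<close> for the complex structure \<open>J\<close>.\<close>

definition rot :: "(real^'d \<Rightarrow> real^'d) \<Rightarrow> real \<Rightarrow> real^'d \<Rightarrow> real^'d" where
  "rot J \<theta> v = cos \<theta> *\<^sub>R v + sin \<theta> *\<^sub>R J v"

lemma rot_simps [simp]: "rot J 0 v = v" "rot J pi v = - v" "rot J (\<theta> + pi) v = - rot J \<theta> v"
  by (simp_all add: rot_def)

lemma linear_rot: "linear J \<Longrightarrow> linear (rot J \<theta>)"
  unfolding rot_def by (intro linear_compose_add linear_compose_scale_right linear_ident)

text \<open>The inverse is the rotation by the opposite angle, \<open>cos \<theta>\<close> minus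
  \<open>sin \<theta>\<close> times \<open>J\<close>.\<close>

lemma inj_rot:
  assumes "linear J" "\<And>v. J (J v) = - v"
  shows "inj (rot J \<theta>)"
proof -
  have "v = 0" if "rot J \<theta> v = 0" for v
  proof -
    have "J (rot J \<theta> v) = cos \<theta> *\<^sub>R J v - sin \<theta> *\<^sub>R v"
      using assms by (simp add: rot_def linear_add linear_scale)
    with that have "cos \<theta> *\<^sub>R J v - sin \<theta> *\<^sub>R v = 0" using linear_0[OF assms(1)] by simp
    moreover have "cos \<theta> * (cos \<theta> * a + sin \<theta> * b) - sin \<theta> * (cos \<theta> * b - sin \<theta> * a) = a" for a b
      using sin_cos_squared_add[of \<theta>] by algebra
    then have "cos \<theta> *\<^sub>R rot J \<theta> v - sin \<theta> *\<^sub>R (cos \<theta> *\<^sub>R J v - sin \<theta> *\<^sub>R v) = v"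
      by (simp add: rot_def vec_eq_iff)
    ultimately show "v = 0" using that by simp
  qed
  then show ?thesis by (simp add: linear_injective_0[OF linear_rot[OF assms(1)]])
qed

lemma bdet_cnj: "bdet (\<lambda>c. \<chi> k. cnj (v c $ k)) = cnj (bdet v)"
  by (simp add: bdet_expand)

text \<open>If all roots were real for every angle, then \<open>G (\<theta>, u)\<close>, the determinant of
  \<open>(1 - u) x + \<i> u R\<^sub>\<theta> y\<close>, would have no zero for \<open>0 \<le> \<theta> \<le> pi\<close> and
  \<open>0 \<le> u \<le> 1\<close>. Its argument is constant along \<open>u = 0\<close> and along \<open>u = 1\<close>, so the change of argument
  in \<open>u\<close> does not depend on \<open>\<theta>\<close>. It changes sign from \<open>\<theta> = 0\<close> to \<open>\<theta> = pi\<close>, where \<open>G\<close> is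
  conjugated, so it vanishes; but \<open>\<i> ^ d = -1\<close> gives the two ends opposite signs.\<close>

lemma exists_rot_has_nonreal_root:
  fixes x y :: "'d::finite option \<Rightarrow> real^'d"
  assumes d: "CARD('d) mod 4 = 2" and J: "linear J" "\<And>v. J (J v) = - v"
    and pos: "bdet x * bdet y > 0"
  shows "\<exists>\<theta>. has_nonreal_root x (\<lambda>c. rot J \<theta> (y c))"
proof (rule ccontr)
  assume "\<not> ?thesis"
  then have ge: "\<bar>bdet (\<lambda>c. rot J \<theta> (y c))\<bar> * \<bar>Im z\<bar> ^ CARD('d) \<le> cmod (cpencil x (\<lambda>c. rot J \<theta> (y c)) z)" for \<theta> z
    by (simp add: has_nonreal_root_def not_less)
  have x0: "bdet x \<noteq> 0" and y0: "bdet y \<noteq> 0" using pos by auto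
  have yr: "bdet (\<lambda>c. rot J \<theta> (y c)) \<noteq> 0" for \<theta>
    using bdet_affine_image_nonzero[OF linear_rot[OF J(1)] inj_rot[OF J] y0, of 0] by simp
  \<comment> \<open>The pencil on the positive imaginary axis, homogenised: \<open>u = 1\<close>
    stands for the point at infinity.\<close>
  define G where "G = (\<lambda>(\<theta>, u). bdet (\<lambda>c. \<chi> k. of_real ((1 - u) * x c $ k) + \<i> * of_real (u * rot J \<theta> (y c) $ k)))"
  have id: "\<i> ^ CARD('d) = -1"
  proof -
    have "\<i> ^ CARD('d) = \<i> ^ (4 * (CARD('d) div 4) + 2)"
      using d by (metis mult_div_mod_eq)
    then show ?thesis by (simp only: power_add power_mult) simp
  qed
  have G0: "G (\<theta>, 0) = of_real (bdet x)" for \<theta>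
    by (simp add: G_def bdet_of_real)
  have G1: "G (\<theta>, 1) = of_real (- bdet (\<lambda>c. rot J \<theta> (y c)))" for \<theta>
  proof -
    have "G (\<theta>, 1) = bdet (\<lambda>c. \<i> *s (\<chi> k. of_real (rot J \<theta> (y c) $ k)))"
      by (simp add: G_def vector_scalar_mult_def)
    then show ?thesis by (simp only: bdet_scale id bdet_of_real) simp
  qed
  have Gnz: "G p \<noteq> 0" if pS: "p \<in> {0..pi} \<times> {0..1}" for p
  proof -
    obtain \<theta> u where p: "p = (\<theta>, u)" "0 \<le> u" "u \<le> 1" using pS by (cases p) auto
    consider "u = 0" | "u = 1" | "0 < u" "u < 1" using p by linarith
    then show ?thesis
    proof cases
      case 3
      \<comment> \<open>\<open>G p\<close> is \<open>(1 - u) ^ d\<close> times the pencil at this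
        point. Its imaginary part is positive, so the assumed bound \<open>ge\<close> excludes a
        zero.\<close>
      let ?z = "\<i> * of_real (u / (1 - u)) :: complex"
      have "of_real (1 - u) * ?z = \<i> * of_real ((1 - u) * (u / (1 - u)))"
        by (simp only: of_real_mult mult_ac)
      then have "of_real (1 - u) * ?z = \<i> * of_real u" using 3 by simp
      then have "of_real ((1 - u) * a) + \<i> * of_real (u * b) = of_real (1 - u) * (of_real a + ?z * of_real b)" for a b
        by (simp only: distrib_left of_real_mult mult.assoc[symmetric])
      then have "G p = bdet (\<lambda>c. of_real (1 - u) *s (\<chi> k. of_real (x c $ k) + ?z * of_real (rot J \<theta> (y c) $ k)))"
        by (simp only: G_def p vector_scalar_mult_def case_prod_conv vec_lambda_beta)
      then have "G p = of_real (1 - u) ^ CARD('d) * cpencil x (\<lambda>c. rot J \<theta> (y c)) ?z"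
        by (simp only: bdet_scale cpencil_def)
      moreover have "cpencil x (\<lambda>c. rot J \<theta> (y c)) ?z \<noteq> 0"
      proof -
        have "Im ?z = u / (1 - u)" by (simp only: Im_i_times Re_complex_of_real)
        then have "0 < \<bar>bdet (\<lambda>c. rot J \<theta> (y c))\<bar> * \<bar>Im ?z\<bar> ^ CARD('d)"
          using 3 yr[of \<theta>] by (simp del: Im_i_times)
        with ge[of \<theta> ?z] show ?thesis by (metis norm_zero not_less)
      qed
      ultimately show ?thesis using 3 by simp
    qed (use p x0 yr in \<open>simp_all add: G0 G1\<close>)
  qed
  have contG: "continuous_on ({0..pi} \<times> {0..1}) G"
    unfolding G_def case_prod_beta rot_def vector_add_component vector_scaleR_component
    by (intro continuous_intros)
  \<comment> \<open>A nonvanishing continuous function on a convex set has a continuous logarithm;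
    \<open>Im (L p)\<close> is the argument of \<open>G p\<close>.\<close>
  obtain L where L: "continuous_on ({0..pi} \<times> {0..1}) L" "\<And>p. p \<in> {0..pi} \<times> {0..1} \<Longrightarrow> G p = exp (L p)"
    using continuous_logarithm_on_contractible[OF contG _ Gnz]
      convex_imp_contractible[OF convex_Times[of "{0..pi}" "{0..1::real}"]] by (auto simp: convex_real_interval)
  have sgnG: "cis (Im (L p)) = sgn (G p)" if "p \<in> {0..pi} \<times> {0..1}" for p
    by (simp add: L(2)[OF that] exp_eq_polar sgn_mult sgn_of_real del: of_real_exp)
  have conth: "continuous_on {0..pi} (\<lambda>\<theta>. Im (L (\<theta>, u)))" if "u \<in> {0..1}" for u
    using that by (intro continuous_on_Im continuous_on_compose2[OF L(1)] continuous_intros) auto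
  have contv: "continuous_on {0..1} (\<lambda>u. Im (L (\<theta>, u)))" if "\<theta> \<in> {0..pi}" for \<theta>
    using that by (intro continuous_on_Im continuous_on_compose2[OF L(1)] continuous_intros) auto
  have sy: "sgn (bdet (\<lambda>c. rot J \<theta> (y c))) = sgn (bdet y)" if "\<theta> \<in> {0..pi}" for \<theta>
  proof -
    have "continuous_on {0..1} (\<lambda>t. bdet (\<lambda>c. rot J (t * \<theta>) (y c)))"
      unfolding rot_def by (intro continuous_intros)
    from sgn_eq_if_nonzero_on_unit_interval[OF this yr] show ?thesis by simp
  qed
  \<comment> \<open>On the edges \<open>u = 0\<close> and \<open>u = 1\<close> the function is real
    of constant sign, so its argument is compared with a constant.\<close>
  have eq0: "Im (L (pi, 0)) = Im (L (0, 0))"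
    using continuous_on_cis_eq[OF _ conth[of 0] continuous_on_const[of _ "Im (L (0, 0))"], of pi 0]
    by (simp add: sgnG G0)
  have eq1: "Im (L (pi, 1)) = Im (L (0, 1))"
    using continuous_on_cis_eq[OF _ conth[of 1] continuous_on_const[of _ "Im (L (0, 1))"], of pi 0]
      sy sy[of 0]
    by (simp add: sgnG G1 sgn_of_real del: of_real_minus)
  have "G (pi, u) = cnj (G (0, u))" for u
    by (simp add: G_def bdet_cnj[symmetric])
  \<comment> \<open>By conjugation \<open>- Im (L (0, u))\<close> is also an argument of
    \<open>G (pi, u)\<close>. With \<open>eq0\<close> and \<open>eq1\<close> this becomes
    \<open>2 * Im (L (0, 1)) = 2 * Im (L (0, 0))\<close>, and the factor 2 cancels.\<close>
  then have "Im (L (pi, 1)) - - Im (L (0, 1)) = Im (L (pi, 0)) - - Im (L (0, 0))"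
    by (intro continuous_on_cis_eq[of "{0..1::real}"] contv continuous_on_minus)
      (auto simp: sgnG cis_cnj[symmetric] sgn_eq)
  with eq0 eq1 have "cis (Im (L (0, 1))) = cis (Im (L (0, 0)))" by simp
  then have "sgn (of_real (- bdet y) :: complex) = sgn (of_real (bdet x))"
    by (simp add: sgnG G0 G1 del: of_real_minus)
  then have "sgn (- bdet y) = sgn (bdet x)"
    by (simp only: sgn_of_real of_real_eq_iff)
  with pos show False by (auto simp: sgn_if zero_less_mult_iff split: if_splits)
qed

subsection \<open>Generic straight motions\<close>

definition seg :: "(nat \<Rightarrow> real^'d) \<Rightarrow> (nat \<Rightarrow> real^'d) \<Rightarrow> real \<Rightarrow> nat \<Rightarrow> real^'d" where
  "seg P Q t i = (1 - t) *\<^sub>R P i + t *\<^sub>R Q i"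

definition indep_at :: "(nat \<Rightarrow> real^'d) \<Rightarrow> nat set \<Rightarrow> bool" where
  "indep_at X S \<longleftrightarrow> inj_on X S \<and> \<not> affine_dependent (X ` S)"

lemma indep_at_insert:
  assumes "indep_at X S" "X s \<notin> affine hull (X ` S)" "s \<notin> S"
  shows "indep_at X (insert s S)"
  using assms affine_independent_insert[of "X ` S" "X s"] hull_inc[of "X s" "X ` S" affine]
  by (auto simp: indep_at_def)

lemma indep_at_cong: "(\<And>i. i \<in> S \<Longrightarrow> X i = Y i) \<Longrightarrow> indep_at X S = indep_at Y S"
  unfolding indep_at_def by (simp cong: inj_on_cong image_cong)

lemma not_negligible_open:
  fixes S :: "'a::euclidean_space set"
  assumes "open S" "S \<noteq> {}" shows "\<not> negligible S"
proof -
  obtain x e where e: "e > 0" "ball x e \<subseteq> S" using assms open_contains_ball by blast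
  have "\<not> negligible (ball x e)" using e(1) by (simp add: negligible_convex_interior interior_open)
  with e(2) show ?thesis using negligible_subset by blast
qed

text \<open>Tuples carry the product topology, so the values of one point that keep the tuple in
  \<open>V\<close> form a nonempty open set, which no null set covers.\<close>

lemma perturb_point:
  fixes V :: "(nat \<Rightarrow> real^'d) set"
  assumes "open V" "Q \<in> V" "negligible N"
  obtains q where "q \<notin> N" "Q(s := q) \<in> V"
proof -
  have "continuous_on UNIV (\<lambda>q. Q(s := q))"
  proof (rule continuous_on_coordinatewise_then_product)
    show "continuous_on UNIV (\<lambda>q. (Q(s := q)) i)" for i
      by (cases "i = s") (auto intro!: continuous_intros)
  qed
  then have "open ((\<lambda>q. Q(s := q)) -` V)"
    using assms(1) by (simp add: open_vimage)
  moreover have "Q s \<in> (\<lambda>q. Q(s := q)) -` V" using assms(2) by simp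
  ultimately have "\<not> negligible ((\<lambda>q. Q(s := q)) -` V)" by (intro not_negligible_open) auto
  then have "\<not> (\<lambda>q. Q(s := q)) -` V \<subseteq> N" using assms(3) negligible_subset by blast
  then show thesis using that by auto
qed

text \<open>The bad positions are parametrised by the time and the coefficients of an affine
  combination: \<open>card T + 1 \<le> d\<close> parameters subject to one linear equation.\<close>

lemma negligible_hits_moving_flat:
  fixes P Q :: "nat \<Rightarrow> real^'d" and p :: "real^'d"
  assumes "finite T" "card T < CARD('d)"
  shows "negligible {q. \<exists>t\<in>{0<..1}. inj_on (seg P Q t) T \<and>
    (1 - t) *\<^sub>R p + t *\<^sub>R q \<in> affine hull (seg P Q t ` T)}" (is "negligible ?B")
proof -
  obtain c :: "nat \<Rightarrow> 'd" where c: "inj_on c T"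
    using card_le_inj[OF assms(1), of "UNIV :: 'd set"] assms(2) by auto
  \<comment> \<open>The coordinates \<open>c j\<close> will hold the affine coefficients; the spare
    coordinate \<open>c0\<close>, available because \<open>card T < CARD('d)\<close>, holds the
    time.\<close>
  have "c ` T \<noteq> UNIV" using card_image[OF c] assms(2) by auto
  then obtain c0 where c0: "c0 \<notin> c ` T" by blast
  \<comment> \<open>Coefficients that sum to 1 lie on a hyperplane, a null set. For empty
    \<open>T\<close> the right-hand side 1 makes it empty.\<close>
  define H where "H = {v :: real^'d. (\<Sum>j\<in>T. axis (c j) 1) \<bullet> v = 1}"
  define S where "S = H \<inter> {v. v $ c0 \<noteq> 0}"
  \<comment> \<open>The position \<open>q\<close> solved from the incidence equation at time
    \<open>v $ c0\<close>. It is differentiable where that time is nonzero, so it maps null sets to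
    null sets.\<close>
  define \<Phi> where "\<Phi> v = (1 / v $ c0) *\<^sub>R ((\<Sum>j\<in>T. v $ c j *\<^sub>R seg P Q (v $ c0) j) - (1 - v $ c0) *\<^sub>R p)" for v :: "real^'d"
  have "negligible H" unfolding H_def by (rule negligible_hyperplane) simp
  then have "negligible S" unfolding S_def by (rule negligible_subset) auto
  have nth: "(\<lambda>v. v $ k) differentiable at v within A" for k :: 'd and v :: "real^'d" and A
    by (rule bounded_linear_imp_differentiable[OF bounded_linear_vec_nth])
  have "\<Phi> differentiable_on S"
    unfolding differentiable_on_def \<Phi>_def seg_def
    by (intro ballI differentiable_scaleR differentiable_diff differentiable_sum differentiable_add
        differentiable_divide differentiable_const nth assms(1)) (auto simp: S_def)
  with \<open>negligible S\<close> have "negligible (\<Phi> ` S)"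
    by (intro negligible_differentiable_image_negligible) auto
  moreover have "?B \<subseteq> \<Phi> ` S"
  proof
    fix q assume "q \<in> ?B"
    then obtain t where t: "0 < t" "inj_on (seg P Q t) T"
      "(1 - t) *\<^sub>R p + t *\<^sub>R q \<in> affine hull (seg P Q t ` T)" by auto
    then obtain u where u: "sum u (seg P Q t ` T) = 1"
        "(\<Sum>v\<in>seg P Q t ` T. u v *\<^sub>R v) = (1 - t) *\<^sub>R p + t *\<^sub>R q"
      using assms(1) by (auto simp: affine_hull_finite)
    define l where "l j = u (seg P Q t j)" for j
    have l: "sum l T = 1" "(\<Sum>j\<in>T. l j *\<^sub>R seg P Q t j) = (1 - t) *\<^sub>R p + t *\<^sub>R q"
      using u t(2) by (simp_all add: sum.reindex l_def)
    define v :: "real^'d" where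
      "v = (\<chi> k. if k = c0 then t else if k \<in> c ` T then l (inv_into T c k) else 0)"
    have vc0: "v $ c0 = t" by (simp add: v_def)
    have vc: "v $ c j = l j" if "j \<in> T" for j
      using that c c0 by (auto simp: v_def)
    have "v \<in> S"
      using t(1) l(1) by (simp add: S_def H_def vc0 inner_sum_left inner_axis' vc)
    moreover have "\<Phi> v = q"
      using t(1) l(2) by (simp add: \<Phi>_def vc0 vc)
    ultimately show "q \<in> \<Phi> ` S" by blast
  qed
  ultimately show ?thesis by (rule negligible_subset)
qed

text \<open>Each new point avoids the null set of targets for which it meets, at some time, the flat
  of the fewer than d earlier points. Time 0 is left out because \<open>P\<close> is fixed.\<close>

lemma dense_indep_along_seg:
  fixes P :: "nat \<Rightarrow> real^'d"
  assumes "finite S" "card S \<le> CARD('d)" "open V" "V \<noteq> {}"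
  shows "\<exists>Q\<in>V. \<forall>t\<in>{0<..1}. indep_at (seg P Q t) S"
  using assms(1,2)
proof (induction S rule: finite_induct)
  case empty
  then show ?case using assms(4) by (auto simp: indep_at_def)
next
  case (insert s S)
  then obtain Q where Q: "Q \<in> V" "\<And>t. t \<in> {0<..1} \<Longrightarrow> indep_at (seg P Q t) S" by auto
  let ?B = "{q. \<exists>t\<in>{0<..1}. inj_on (seg P Q t) S \<and>
    (1 - t) *\<^sub>R P s + t *\<^sub>R q \<in> affine hull (seg P Q t ` S)}"
  have "negligible ?B"
    using insert.prems insert.hyps by (intro negligible_hits_moving_flat) auto
  then obtain q where q: "q \<notin> ?B" "Q(s := q) \<in> V" using perturb_point[OF assms(3) Q(1)] by blast
  have eq: "seg P (Q(s := q)) t i = seg P Q t i" if "i \<in> S" for t i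
    using that insert.hyps by (auto simp: seg_def)
  have "indep_at (seg P (Q(s := q)) t) (insert s S)" if t: "t \<in> {0<..1}" for t
  proof (rule indep_at_insert)
    show "indep_at (seg P (Q(s := q)) t) S"
      using Q(2)[OF t] by (subst indep_at_cong[OF eq])
    have "seg P (Q(s := q)) t ` S = seg P Q t ` S" using eq by (intro image_cong) auto
    moreover have "seg P (Q(s := q)) t s = (1 - t) *\<^sub>R P s + t *\<^sub>R q" by (simp add: seg_def)
    ultimately show "seg P (Q(s := q)) t s \<notin> affine hull (seg P (Q(s := q)) t ` S)"
      using q(1) t Q(2)[OF t] by (auto simp: indep_at_def)
  qed (use insert.hyps in simp)
  with q(2) show ?case by blast
qed

lemma indep_at_imp_tdet_nonzero:
  fixes X :: "nat \<Rightarrow> real^'d::{finite,linorder}"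
  assumes "I \<in> index_sets CARD('d) n" "indep_at X I"
  shows "tdet I X \<noteq> 0"
proof
  assume "tdet I X = 0"
  then obtain a b where ab: "a \<noteq> 0" "X ` I \<subseteq> {x. a \<bullet> x = b}"
    using on_common_hyperplane_iff_tdet[OF assms(1), of X] unfolding on_common_hyperplane_def by blast
  have "int (card (X ` I)) = aff_dim (X ` I) + 1"
    using assms(2) by (intro aff_dim_affine_independent) (simp add: indep_at_def)
  moreover have "card (X ` I) = CARD('d) + 1"
    using assms(2) index_setsD(2)[OF assms(1)] by (simp add: indep_at_def card_image)
  moreover have "aff_dim (X ` I) \<le> int CARD('d) - 1"
    using aff_dim_subset[OF ab(2)] aff_dim_hyperplane[OF ab(1), of b] by simp
  ultimately show False by simp
qed

section \<open>Degeneration times as roots of the pencil\<close>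

lemma tdet_scale:
  fixes X :: "nat \<Rightarrow> real^'d::{finite,linorder}"
  shows "tdet I (\<lambda>i. s *\<^sub>R X i) = s ^ CARD('d) * tdet I X"
  using bdet_scale[of s "\<lambda>c. X (idx I c)"] by (simp add: tdet_def scalar_mult_eq_scaleR)

text \<open>The substitution \<open>s = t / (1 - t)\<close> identifies the times in [0, 1) with the
  nonnegative parameters of the pencil.\<close>

lemma tdet_seg:
  fixes P Q :: "nat \<Rightarrow> real^'d::{finite,linorder}"
  assumes "t \<noteq> 1"
  shows "tdet I (seg P Q t) = (1 - t) ^ CARD('d) * tdet I (\<lambda>i. P i + (t / (1 - t)) *\<^sub>R Q i)"
proof -
  have "seg P Q t = (\<lambda>i. (1 - t) *\<^sub>R (P i + (t / (1 - t)) *\<^sub>R Q i))"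
    using assms by (simp add: fun_eq_iff seg_def scaleR_add_right)
  then show ?thesis by (simp only: tdet_scale)
qed

lemma real_roots_tdet:
  fixes P Q :: "nat \<Rightarrow> real^'d::{finite,linorder}" and I :: "nat set"
  defines "R \<equiv> {s. tdet I (\<lambda>i. P i + s *\<^sub>R Q i) = 0}"
  assumes "tdet I P \<noteq> 0"
  shows "finite R" "card R \<le> CARD('d)"
    "has_nonreal_root (\<lambda>c. P (idx I c)) (\<lambda>c. Q (idx I c)) \<Longrightarrow> card R < CARD('d)"
  using real_roots_bdet[of "\<lambda>c. P (idx I c)" "\<lambda>c. Q (idx I c)"] assms(2)
  unfolding R_def tdet_def by auto

lemma finite_seg_roots:
  fixes P Q :: "nat \<Rightarrow> real^'d::{finite,linorder}"
  assumes "tdet I P \<noteq> 0"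
  shows "finite {t. tdet I (seg P Q t) = 0}"
proof (rule finite_subset)
  let ?R = "{s. tdet I (\<lambda>i. P i + s *\<^sub>R Q i) = 0}"
  \<comment> \<open>Time 1 is the parameter at infinity and is added by hand, since
    \<open>tdet I Q\<close> may vanish here.\<close>
  show "{t. tdet I (seg P Q t) = 0} \<subseteq> insert 1 ((\<lambda>s. s / (1 + s)) ` ?R)"
  proof
    fix t assume t: "t \<in> {t. tdet I (seg P Q t) = 0}"
    show "t \<in> insert 1 ((\<lambda>s. s / (1 + s)) ` ?R)"
    proof (cases "t = 1")
      case False
      then have "t / (1 - t) \<in> ?R" using t tdet_seg[OF False, of I P Q] by simp
      moreover have "t = (t / (1 - t)) / (1 + t / (1 - t))" using False by (simp add: field_simps)
      ultimately show ?thesis by blast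
    qed simp
  qed
  show "finite (insert 1 ((\<lambda>s. s / (1 + s)) ` ?R))" using real_roots_tdet(1)[OF assms] by simp
qed

lemma card_seg_roots:
  fixes P Q :: "nat \<Rightarrow> real^'d::{finite,linorder}"
  assumes "tdet I P \<noteq> 0" "tdet I Q \<noteq> 0"
  shows "card {t\<in>{0..1}. tdet I (seg P Q t) = 0} + card {t\<in>{0..1}. tdet I (seg P (\<lambda>i. - Q i) t) = 0}
    \<le> card {s. tdet I (\<lambda>i. P i + s *\<^sub>R Q i) = 0}" (is "card ?A + card ?B \<le> card ?R")
proof -
  have mQ: "tdet I (\<lambda>i. - Q i) \<noteq> 0"
    using assms(2) tdet_scale[of I "-1" Q] by simp
  \<comment> \<open>Both ends of the segments are nondegenerate, so no event sits at parameter 0,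
    which would be shared, or at infinity.\<close>
  have A: "0 < t \<and> t < 1" if "t \<in> ?A" for t
    using that assms by (cases "t = 0 \<or> t = 1") (auto simp: seg_def[abs_def])
  have B: "0 < t \<and> t < 1" if "t \<in> ?B" for t
    using that assms mQ by (cases "t = 0 \<or> t = 1") (auto simp: seg_def[abs_def])
  let ?f = "\<lambda>t::real. t / (1 - t)"
  have inj: "inj_on ?f {0<..<1}" by (auto simp: inj_on_def field_simps)
  have fin: "finite ?A" "finite ?B"
    using finite_seg_roots[OF assms(1)] by (simp_all add: rev_finite_subset subset_eq)
  have "card ?A = card (?f ` ?A)" by (rule card_image[symmetric], rule inj_on_subset[OF inj]) (use A in auto)
  moreover have "card ?B = card ((\<lambda>t. - ?f t) ` ?B)"
  proof (rule card_image[symmetric], rule inj_onI)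
    fix a b assume ab: "a \<in> ?B" "b \<in> ?B" "- ?f a = - ?f b"
    have "a \<in> {0<..<1}" "b \<in> {0<..<1}" using B[OF ab(1)] B[OF ab(2)] by auto
    moreover have "?f a = ?f b" using ab(3) by linarith
    ultimately show "a = b" using inj by (meson inj_onD)
  qed
  moreover have "card (?f ` ?A) + card ((\<lambda>t. - ?f t) ` ?B) = card (?f ` ?A \<union> (\<lambda>t. - ?f t) ` ?B)"
  proof (rule card_Un_disjoint[symmetric])
    have "0 < ?f t" if "0 < t \<and> t < 1" for t using that by simp
    then have "\<forall>x\<in>?f ` ?A. 0 < x" "\<forall>x\<in>(\<lambda>t. - ?f t) ` ?B. x < 0" using A B by fastforce+
    then show "?f ` ?A \<inter> (\<lambda>t. - ?f t) ` ?B = {}" by (meson disjoint_iff less_asym)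
  qed (use fin in auto)
  moreover have "?f ` ?A \<union> (\<lambda>t. - ?f t) ` ?B \<subseteq> ?R"
  proof (intro Un_least image_subsetI)
    fix t assume t: "t \<in> ?A"
    with A[OF t] show "?f t \<in> ?R" using tdet_seg[of t I P Q] by simp
  next
    fix t assume t: "t \<in> ?B"
    with B[OF t] show "- ?f t \<in> ?R" using tdet_seg[of t I P "\<lambda>i. - Q i"] by simp
  qed
  then have "card (?f ` ?A \<union> (\<lambda>t. - ?f t) ` ?B) \<le> card ?R"
    by (rule card_mono[OF real_roots_tdet(1)[OF assms(1)]])
  ultimately show ?thesis by linarith
qed

text \<open>At a single time even d points span only a null set. Sweeping over all times, as in
  \<open>negligible_hits_moving_flat\<close>, costs one dimension and allows only d - 1
  points.\<close>

lemma negligible_at_time_dependent: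
  fixes p :: "real^'d" and K :: "(real^'d) set"
  assumes "finite K" "card K \<le> CARD('d)" "t \<noteq> 0"
  shows "negligible {q. (1 - t) *\<^sub>R p + t *\<^sub>R q \<in> affine hull K}"
proof -
  have "aff_dim K < CARD('d)" using aff_dim_le_card[OF assms(1)] assms(2) by simp
  then obtain a b where ab: "a \<noteq> 0" "affine hull K \<subseteq> {x. a \<bullet> x = b}"
    using aff_lowdim_subset_hyperplane[of "affine hull K"] by auto
  have "negligible {q. (t *\<^sub>R a) \<bullet> q = b - (1 - t) * (a \<bullet> p)}"
    using ab(1) assms(3) by (intro negligible_hyperplane) simp
  moreover have "{q. (1 - t) *\<^sub>R p + t *\<^sub>R q \<in> affine hull K} \<subseteq> {q. (t *\<^sub>R a) \<bullet> q = b - (1 - t) * (a \<bullet> p)}"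
    using ab(2) by (force simp: inner_add_right)
  ultimately show ?thesis by (rule negligible_subset)
qed

text \<open>Choose \<open>i\<close> in \<open>I\<close> outside \<open>J\<close>. The finitely many
  times at which \<open>J\<close> degenerates do not depend on \<open>Q i\<close>. First make the
  other d points of \<open>I\<close> independent at all positive times, then move \<open>Q i\<close>
  off their flats at those finitely many times.\<close>

lemma dense_no_double_degeneracy:
  fixes P :: "nat \<Rightarrow> real^'d::{finite,linorder}"
  assumes IJ: "I \<in> index_sets CARD('d) n" "J \<in> index_sets CARD('d) n" "I \<noteq> J"
    and P: "tdet J P \<noteq> 0" and V: "open V" "V \<noteq> {}"
  shows "\<exists>Q\<in>V. \<forall>t\<in>{0..1}. \<not> (tdet I (seg P Q t) = 0 \<and> tdet J (seg P Q t) = 0)"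
proof -
  note I = index_setsD[OF IJ(1)] and J = index_setsD[OF IJ(2)]
  have "\<not> I \<subseteq> J" using IJ(3) card_subset_eq[OF J(1)] I(2) J(2) by auto
  then obtain i where i: "i \<in> I" "i \<notin> J" by blast
  let ?K = "I - {i}"
  have K: "finite ?K" "card ?K = CARD('d)" "insert i ?K = I" using I i by auto
  have "\<exists>Q\<in>V. \<forall>t\<in>{0<..1}. indep_at (seg P Q t) ?K"
    using dense_indep_along_seg[OF K(1) _ V] K(2) by simp
  then obtain Q where Q: "Q \<in> V" "\<And>t. t \<in> {0<..1} \<Longrightarrow> indep_at (seg P Q t) ?K" by blast
  let ?T = "{t. tdet J (seg P Q t) = 0} \<inter> {0<..1}"
  let ?B = "\<Union>t\<in>?T. {q. (1 - t) *\<^sub>R P i + t *\<^sub>R q \<in> affine hull (seg P Q t ` ?K)}"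
  have "negligible ?B"
    using K finite_seg_roots[OF P] card_image_le[OF K(1)]
    by (intro negligible_Union) (auto intro!: negligible_at_time_dependent)
  then obtain q where q: "q \<notin> ?B" "Q(i := q) \<in> V" using perturb_point[OF V(1) Q(1)] by blast
  have eq: "seg P (Q(i := q)) t k = seg P Q t k" if "k \<noteq> i" for t k
    using that by (auto simp: seg_def)
  have eqJ: "tdet J (seg P (Q(i := q)) t) = tdet J (seg P Q t)" for t
  proof -
    have "idx J c \<noteq> i" for c :: "'d option"
      using bij_betw_apply[OF bij_betw_idx[OF IJ(2)], of c] i(2) by auto
    then show ?thesis by (simp add: tdet_def eq)
  qed
  have "tdet I (seg P (Q(i := q)) t) \<noteq> 0" if t: "t \<in> {0..1}" "tdet J (seg P (Q(i := q)) t) = 0" for t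
  proof -
    have "t \<noteq> 0"
    proof
      assume "t = 0"
      with t(2) P show False by (simp add: seg_def[abs_def])
    qed
    with t eqJ have tT: "t \<in> ?T" "t \<in> {0<..1}" by auto
    have "indep_at (seg P (Q(i := q)) t) (insert i ?K)"
    proof (rule indep_at_insert)
      show "indep_at (seg P (Q(i := q)) t) ?K"
        using Q(2)[OF tT(2)] indep_at_cong[of ?K "seg P (Q(i := q)) t" "seg P Q t"] eq by auto
      have "seg P (Q(i := q)) t ` ?K = seg P Q t ` ?K" using eq by (intro image_cong) auto
      moreover have "seg P (Q(i := q)) t i = (1 - t) *\<^sub>R P i + t *\<^sub>R q" by (simp add: seg_def)
      ultimately show "seg P (Q(i := q)) t i \<notin> affine hull (seg P (Q(i := q)) t ` ?K)"
        using q(1) tT(1) by auto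
    qed simp
    then show ?thesis using indep_at_imp_tdet_nonzero[OF IJ(1)] K(3) by simp
  qed
  with q(2) show ?thesis by blast
qed

lemma open_Collect_ball_nonzero:
  fixes f :: "'a::topological_space \<Rightarrow> 'b::topological_space \<Rightarrow> 'c::real_normed_vector"
  assumes "compact K" "continuous_on UNIV (\<lambda>(x, t). f x t)"
  shows "open {x. \<forall>t\<in>K. f x t \<noteq> 0}"
proof (subst open_subopen, intro ballI)
  fix x assume x: "x \<in> {x. \<forall>t\<in>K. f x t \<noteq> 0}"
  let ?W = "(\<lambda>(x, t). f x t) -` (- {0})"
  have "open ?W" using assms(2) by (intro open_vimage open_Compl closed_singleton)
  moreover have "{x} \<times> K \<subseteq> ?W" using x by auto
  ultimately obtain X where "x \<in> X" "open X" "X \<times> K \<subseteq> ?W" using Elementary_Topology.tube_lemma[OF assms(1)] by metis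
  then show "\<exists>T. open T \<and> x \<in> T \<and> T \<subseteq> {x. \<forall>t\<in>K. f x t \<noteq> 0}" by (intro exI[of _ X]) auto
qed

lemma finite_open_dense_Inter:
  assumes "finite A" "\<And>a. a \<in> A \<Longrightarrow> open (U a)"
    "\<And>a V. a \<in> A \<Longrightarrow> open V \<Longrightarrow> V \<noteq> {} \<Longrightarrow> U a \<inter> V \<noteq> {}" "open V" "V \<noteq> {}"
  shows "V \<inter> (\<Inter>a\<in>A. U a) \<noteq> {}"
  using assms
proof (induction A arbitrary: V rule: finite_induct)
  case (insert a A)
  have "(V \<inter> U a) \<inter> (\<Inter>a\<in>A. U a) \<noteq> {}"
    using insert.prems by (intro insert.IH) (auto simp: Int_commute)
  then show ?case by (simp add: Int_assoc)
qed simp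

lemma continuous_on_seg [continuous_intros]:
  fixes P :: "nat \<Rightarrow> real^'d"
  assumes "continuous_on S t" "\<And>i. continuous_on S (\<lambda>y. Q y i)"
  shows "continuous_on S (\<lambda>y. seg P (Q y) (t y) i)"
  unfolding seg_def by (intro continuous_intros assms)

lemma continuous_on_coordinate: "continuous_on S f \<Longrightarrow> continuous_on S (\<lambda>y. f y i)"
  for f :: "'a::topological_space \<Rightarrow> 'i \<Rightarrow> 'b::topological_space"
  by (rule continuous_on_product_then_coordinatewise)

lemma generic_target:
  fixes P :: "nat \<Rightarrow> real^'d::{finite,linorder}"
  assumes P: "general_position n P" and V: "open V" "V \<noteq> {}"
  shows "\<exists>Q\<in>V. \<forall>I\<in>index_sets CARD('d) n. \<forall>J\<in>index_sets CARD('d) n. I \<noteq> J \<longrightarrow> (\<forall>t\<in>{0..1}.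
     \<not> (tdet I (seg P Q t) = 0 \<and> tdet J (seg P Q t) = 0) \<and>
     \<not> (tdet I (seg P (\<lambda>i. - Q i) t) = 0 \<and> tdet J (seg P (\<lambda>i. - Q i) t) = 0))"
proof -
  \<comment> \<open>The sum vanishes exactly when both determinants do, which turns the pair
    condition into nonvanishing of one continuous function.\<close>
  define bad where "bad = (\<lambda>I J Q t. \<bar>tdet I (seg P Q t)\<bar> + \<bar>tdet J (seg P Q t)\<bar>)"
  \<comment> \<open>Negating the target is a homeomorphism and an involution, so density for the
    target \<open>- Q\<close> follows from density for \<open>Q\<close>.\<close>
  define \<sigma> where "\<sigma> = (\<lambda>(b::bool) (Q :: nat \<Rightarrow> real^'d::{finite,linorder}) i. if b then - Q i else Q i)"
  have \<sigma>\<sigma>: "\<sigma> b (\<sigma> b Q) = Q" for b Q by (simp add: \<sigma>_def fun_eq_iff)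
  have \<sigma>c: "continuous_on S (\<sigma> b)" for S b
  proof (rule continuous_on_coordinatewise_then_product)
    show "continuous_on S (\<lambda>Q. \<sigma> b Q i)" for i
      using continuous_on_coordinate[OF continuous_on_id, of S i]
      by (cases b) (simp_all add: \<sigma>_def continuous_on_minus)
  qed
  define U where "U = (\<lambda>(I, J, b). {Q. \<forall>t\<in>{0..1::real}. bad I J (\<sigma> b Q) t \<noteq> 0})"
  let ?S = "index_sets CARD('d) n"
  let ?A = "{(I, J, b :: bool). I \<in> ?S \<and> J \<in> ?S \<and> I \<noteq> J}"
  have "?A \<subseteq> ?S \<times> ?S \<times> UNIV" by auto
  then have "finite ?A" by (rule finite_subset) simp
  have badc: "continuous_on UNIV (\<lambda>(Q, t). bad I J (\<sigma> b Q) t)" if "I \<in> ?S" "J \<in> ?S" for I J b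
  proof -
    have "continuous_on UNIV (\<lambda>y :: (nat \<Rightarrow> real^'d::{finite,linorder}) \<times> real. \<sigma> b (fst y) i)" for i
      by (rule continuous_on_coordinate, rule continuous_on_compose2[OF \<sigma>c[of UNIV]])
        (auto intro: continuous_on_fst continuous_on_id)
    then have c: "continuous_on UNIV (\<lambda>y :: (nat \<Rightarrow> real^'d::{finite,linorder}) \<times> real. tdet H (seg P (\<sigma> b (fst y)) (snd y)))"
      if "H \<in> ?S" for H
      by (intro continuous_on_tdet[OF that] continuous_on_seg continuous_on_snd continuous_on_id)
    show ?thesis
      unfolding bad_def case_prod_beta by (intro continuous_on_add continuous_on_rabs c that)
  qed
  have open_U: "open (U a)" if "a \<in> ?A" for a
  proof -
    obtain I J b where a: "a = (I, J, b)" by (cases a)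
    show ?thesis
      using that unfolding a U_def by (auto intro!: open_Collect_ball_nonzero badc)
  qed
  have dense_U: "U a \<inter> W \<noteq> {}" if "a \<in> ?A" "open W" "W \<noteq> {}" for a W
  proof -
    obtain I J b where a: "a = (I, J, b)" by (cases a)
    have "open (\<sigma> b -` W)" by (rule open_vimage[OF that(2) \<sigma>c])
    moreover have "\<sigma> b -` W \<noteq> {}" using that(3) \<sigma>\<sigma>[of b] by (metis all_not_in_conv vimageI)
    moreover have "tdet J P \<noteq> 0" "I \<in> ?S" "J \<in> ?S" "I \<noteq> J"
      using that(1) P a by (auto simp: general_position_iff_tdet)
    ultimately obtain Q where Q: "Q \<in> \<sigma> b -` W"
      "\<forall>t\<in>{0..1}. \<not> (tdet I (seg P Q t) = 0 \<and> tdet J (seg P Q t) = 0)"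
      using dense_no_double_degeneracy[of I n J P "\<sigma> b -` W"] by blast
    then have "\<sigma> b Q \<in> U a" by (auto simp: a U_def \<sigma>\<sigma> bad_def)
    with Q(1) show ?thesis by auto
  qed
  have "V \<inter> (\<Inter>a\<in>?A. U a) \<noteq> {}"
    by (rule finite_open_dense_Inter[OF \<open>finite ?A\<close> open_U dense_U V])
  then obtain Q where "Q \<in> V \<inter> (\<Inter>a\<in>?A. U a)" unfolding ex_in_conv[symmetric] by (elim exE)
  then have Q: "Q \<in> V" "\<And>a. a \<in> ?A \<Longrightarrow> Q \<in> U a" by blast+
  show ?thesis
  proof (intro bexI[OF _ Q(1)] ballI impI conjI)
    fix I J t assume IJ: "I \<in> ?S" "J \<in> ?S" "I \<noteq> J" and t: "t \<in> {0..1::real}"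
    show "\<not> (tdet I (seg P Q t) = 0 \<and> tdet J (seg P Q t) = 0)"
    proof -
      have "Q \<in> U (I, J, False)" using IJ by (intro Q(2)) simp
      then have "bad I J (\<sigma> False Q) t \<noteq> 0" using t unfolding U_def by simp
      then show ?thesis by (auto simp: bad_def \<sigma>_def)
    qed
    show "\<not> (tdet I (seg P (\<lambda>i. - Q i) t) = 0 \<and> tdet J (seg P (\<lambda>i. - Q i) t) = 0)"
    proof -
      have "Q \<in> U (I, J, True)" using IJ by (intro Q(2)) simp
      then have "bad I J (\<sigma> True Q) t \<noteq> 0" using t unfolding U_def by simp
      then show ?thesis by (auto simp: bad_def \<sigma>_def)
    qed
  qed
qed

lemma is_motion_seg:
  fixes P Q :: "nat \<Rightarrow> real^'d::{finite,linorder}"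
  assumes P: "general_position n P"
    and Q: "\<And>I J t. I \<in> index_sets CARD('d) n \<Longrightarrow> J \<in> index_sets CARD('d) n \<Longrightarrow> I \<noteq> J \<Longrightarrow> t \<in> {0..1} \<Longrightarrow>
      \<not> (tdet I (seg P Q t) = 0 \<and> tdet J (seg P Q t) = 0)"
  shows "is_motion n P Q (seg P Q)"
    and "card (degenerate_times n (seg P Q)) \<le>
      (\<Sum>I\<in>index_sets CARD('d) n. card {t\<in>{0..1}. tdet I (seg P Q t) = 0})"
proof -
  let ?S = "index_sets CARD('d) n"
  have dt: "degenerate_times n (seg P Q) = (\<Union>I\<in>?S. {t\<in>{0..1}. tdet I (seg P Q t) = 0})"
    by (auto simp: degenerate_times_def general_position_iff_tdet)
  show "card (degenerate_times n (seg P Q)) \<le> (\<Sum>I\<in>?S. card {t\<in>{0..1}. tdet I (seg P Q t) = 0})"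
    unfolding dt by (rule card_UN_le) simp
  have "finite {t\<in>{0..1}. tdet I (seg P Q t) = 0}" if "I \<in> ?S" for I
    using finite_seg_roots[of I P Q] P that by (simp add: general_position_iff_tdet)
  then have fin: "finite (degenerate_times n (seg P Q))" unfolding dt by auto
  show "is_motion n P Q (seg P Q)"
    unfolding is_motion_def
  proof (intro conjI ballI allI impI fin)
    fix t assume t: "t \<in> degenerate_times n (seg P Q)"
    then obtain I where I: "I \<in> ?S" "tdet I (seg P Q t) = 0" "t \<in> {0..1}" unfolding dt by auto
    show "\<exists>!I. I \<in> ?S \<and> on_common_hyperplane (seg P Q t ` I)"
    proof (rule ex1I[of _ I])
      show "I \<in> ?S \<and> on_common_hyperplane (seg P Q t ` I)"
        using I by (simp add: on_common_hyperplane_iff_tdet)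
      fix J assume "J \<in> ?S \<and> on_common_hyperplane (seg P Q t ` J)"
      then have "J \<in> ?S" "tdet J (seg P Q t) = 0"
        using on_common_hyperplane_iff_tdet[of J n "seg P Q t"] by auto
      then show "J = I" using Q[OF I(1), of J t] I by blast
    qed
  qed (auto simp: seg_def intro!: continuous_intros)
qed

subsection \<open>Fat tuples\<close>

lemma card_int_floor_range_le:
  assumes "0 \<le> w"
  shows "real (card {\<lfloor>- w\<rfloor>..\<lfloor>w\<rfloor>}) \<le> 2 * w + 2"
  using assms by simp linarith

text \<open>Points are distinguished by the cell of side \<open>h\<close> that contains them, measured along
  the linear form in place of the coordinate in which the form is largest.\<close>

lemma card_slab_le:
  fixes p :: "nat \<Rightarrow> real^'d" and a :: "real^'d"
  assumes sep: "\<And>i j. i < n \<Longrightarrow> j < n \<Longrightarrow> i \<noteq> j \<Longrightarrow> 2 * real CARD('d) * h \<le> dist (p i) (p j)"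
    and bound: "\<And>i. i < n \<Longrightarrow> norm (p i) \<le> 1"
    and a: "a $ j \<noteq> 0" "\<And>c. \<bar>a $ c\<bar> \<le> \<bar>a $ j\<bar>" and h: "h > 0" and \<delta>: "\<delta> > 0"
  shows "real (card {i. i < n \<and> \<bar>a \<bullet> p i + b\<bar> < \<delta> * \<bar>a $ j\<bar>})
    \<le> (2 / h + 2) ^ (CARD('d) - 1) * (2 * \<delta> / h + 2)"
proof -
  let ?B = "{i. i < n \<and> \<bar>a \<bullet> p i + b\<bar> < \<delta> * \<bar>a $ j\<bar>}"
  define f where "f i c = (if c = j then \<lfloor>(a \<bullet> p i + b) / (\<bar>a $ j\<bar> * h)\<rfloor> else \<lfloor>p i $ c / h\<rfloor>)" for i c
  define F where "F c = (if c = j then {\<lfloor>- (\<delta> / h)\<rfloor>..\<lfloor>\<delta> / h\<rfloor>} else {\<lfloor>- (1 / h)\<rfloor>..\<lfloor>1 / h\<rfloor>})" for c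
  have aj: "\<bar>a $ j\<bar> > 0" using a(1) by simp
  have range: "f i \<in> Pi\<^sub>E UNIV F" if i: "i \<in> ?B" for i
  proof -
    have "f i c \<in> F c" for c
    proof (cases "c = j")
      case True
      have "\<bar>(a \<bullet> p i + b) / (\<bar>a $ j\<bar> * h)\<bar> \<le> \<delta> / h"
        using i aj h by (simp add: abs_mult field_simps)
      then have "- (\<delta> / h) \<le> (a \<bullet> p i + b) / (\<bar>a $ j\<bar> * h)" "(a \<bullet> p i + b) / (\<bar>a $ j\<bar> * h) \<le> \<delta> / h"
        by linarith+
      then show ?thesis using True by (simp add: f_def F_def floor_mono)
    next
      case False
      have "\<bar>p i $ c\<bar> \<le> 1" using i bound[of i] component_le_norm_cart[of "p i" c] by simp
      then have "- (1 / h) \<le> p i $ c / h" "p i $ c / h \<le> 1 / h" using h by (simp_all add: field_simps)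
      then show ?thesis using False by (simp add: f_def F_def floor_mono)
    qed
    then show ?thesis by auto
  qed
  have inj: "inj_on f ?B"
  proof (rule inj_onI, rule ccontr)
    fix i k assume ik: "i \<in> ?B" "k \<in> ?B" "f i = f k" "i \<noteq> k"
    let ?v = "p i - p k"
    have floor_less: "\<bar>x - y\<bar> < 1" if "\<lfloor>x\<rfloor> = \<lfloor>y\<rfloor>" for x y :: real using that by linarith
    have other: "\<bar>?v $ c\<bar> < h" if "c \<noteq> j" for c
    proof -
      have "\<bar>p i $ c / h - p k $ c / h\<bar> < 1"
        using fun_cong[OF ik(3), of c] that by (intro floor_less) (simp add: f_def)
      then show ?thesis using h by (simp add: diff_divide_distrib[symmetric] abs_less_iff field_simps)
    qed
    have "\<bar>(a \<bullet> p i + b) / (\<bar>a $ j\<bar> * h) - (a \<bullet> p k + b) / (\<bar>a $ j\<bar> * h)\<bar> < 1"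
      using fun_cong[OF ik(3), of j] by (intro floor_less) (simp add: f_def)
    then have "\<bar>(a \<bullet> ?v) / (\<bar>a $ j\<bar> * h)\<bar> < 1"
      by (simp add: diff_divide_distrib[symmetric] inner_diff_right)
    then have form: "\<bar>a \<bullet> ?v\<bar> < \<bar>a $ j\<bar> * h" using aj h by (simp add: abs_mult field_simps)
    have card: "real (card (UNIV - {j})) = real CARD('d) - 1"
      by (simp add: card_Diff_singleton of_nat_diff Suc_leI)
    have split: "a \<bullet> ?v = a $ j * ?v $ j + (\<Sum>c\<in>UNIV - {j}. a $ c * ?v $ c)"
      by (simp add: inner_vec_def sum.remove[of UNIV j])
    have "\<bar>\<Sum>c\<in>UNIV - {j}. a $ c * ?v $ c\<bar> \<le> (\<Sum>c\<in>UNIV - {j}. \<bar>a $ j\<bar> * h)"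
    proof (intro order_trans[OF sum_abs] sum_mono)
      fix c assume "c \<in> UNIV - {j}"
      then show "\<bar>a $ c * ?v $ c\<bar> \<le> \<bar>a $ j\<bar> * h"
        unfolding abs_mult using other[of c] a(2)[of c] by (intro mult_mono) auto
    qed
    also have "\<dots> = (real CARD('d) - 1) * (\<bar>a $ j\<bar> * h)" using card by simp
    \<comment> \<open>The form and the d - 1 other coordinates bound the remaining coordinate by d *
      h. Adding the other coordinates gives less than \<open>2 * d * h\<close>, the separation
      assumed in \<open>sep\<close>.\<close>
    finally have "\<bar>a $ j * ?v $ j\<bar> < real CARD('d) * (\<bar>a $ j\<bar> * h)"
      using form split by (simp add: algebra_simps)
    then have "\<bar>a $ j\<bar> * \<bar>?v $ j\<bar> < \<bar>a $ j\<bar> * (real CARD('d) * h)" by (simp add: abs_mult mult_ac)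
    then have vj: "\<bar>?v $ j\<bar> < real CARD('d) * h" using aj by (simp only: mult_less_cancel_left_pos)
    have "norm ?v \<le> (\<Sum>c\<in>UNIV. \<bar>?v $ c\<bar>)" by (rule norm_le_l1_cart)
    also have "\<dots> = \<bar>?v $ j\<bar> + (\<Sum>c\<in>UNIV - {j}. \<bar>?v $ c\<bar>)" by (simp add: sum.remove[of UNIV j])
    also have "(\<Sum>c\<in>UNIV - {j}. \<bar>?v $ c\<bar>) \<le> (\<Sum>c\<in>UNIV - {j}. h)"
      using other by (intro sum_mono less_imp_le) auto
    also have "\<dots> = (real CARD('d) - 1) * h" using card by simp
    finally have "norm ?v < 2 * real CARD('d) * h" using vj h by (simp add: algebra_simps)
    with sep[of i k] ik show False by (simp add: dist_norm)
  qed
  have "card ?B \<le> card (Pi\<^sub>E UNIV F)"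
    using range by (intro card_inj_on_le[OF inj]) (auto intro!: finite_PiE simp: F_def)
  also have "card (Pi\<^sub>E UNIV F) = (\<Prod>c\<in>UNIV. card (F c))" by (simp add: card_PiE)
  finally have "real (card ?B) \<le> (\<Prod>c\<in>UNIV. real (card (F c)))"
    by (simp only: of_nat_prod[symmetric] of_nat_le_iff)
  also have "\<dots> = real (card (F j)) * (\<Prod>c\<in>UNIV - {j}. real (card (F c)))"
    by (simp add: prod.remove[of UNIV j])
  also have "\<dots> \<le> (2 * \<delta> / h + 2) * (\<Prod>c\<in>UNIV - {j}. 2 / h + 2)"
  proof (rule mult_mono)
    show "real (card (F j)) \<le> 2 * \<delta> / h + 2"
      using card_int_floor_range_le[of "\<delta> / h"] h \<delta> by (simp add: F_def)
    show "(\<Prod>c\<in>UNIV - {j}. real (card (F c))) \<le> (\<Prod>c\<in>UNIV - {j}. 2 / h + 2)"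
      using card_int_floor_range_le[of "1 / h"] h by (intro prod_mono) (auto simp: F_def)
  qed (use h \<delta> in \<open>auto intro!: prod_nonneg\<close>)
  also have "(\<Prod>c\<in>UNIV - {j}. 2 / h + 2) = (2 / h + 2) ^ (CARD('d) - 1)"
    by (simp add: card_Diff_singleton)
  finally show ?thesis by (simp add: mult.commute)
qed

text \<open>The side \<open>h\<close> makes \<open>2 * d * h\<close> the separation of the
  normalised points. The bound n / 4 is chosen so that one slab in each of two tuples removes at
  most half of the points.\<close>

lemma slab_parameters:
  fixes \<alpha> :: real and d :: nat
  assumes "\<alpha> > 0" "d > 0"
  obtains \<delta> n0 where "\<delta> > 0" "n0 \<ge> (2::nat)"
    "\<And>n h. n \<ge> n0 \<Longrightarrow> h = 1 / (2 * real d * \<alpha> * real n powr (1 / real d)) \<Longrightarrow>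
      (2 / h + 2) ^ (d - 1) * (2 * \<delta> / h + 2) \<le> real n / 4"
proof -
  define A where "A = 2 * real d * \<alpha>"
  \<comment> \<open>With \<open>r = n powr (1 / d)\<close> the count is at most
    \<open>2 * A * C * \<delta> * n + 2 * C * r ^ (d - 1)\<close>. The choice of
    \<open>\<delta>\<close> makes the first term n / 8, and \<open>r \<ge> 16 * C\<close>, ensured
    by \<open>n0\<close>, does the same for the second.\<close>
  define C where "C = (2 * A + 2) ^ (d - 1)"
  define \<delta> where "\<delta> = 1 / (16 * A * C)"
  have A: "A > 0" using assms by (simp add: A_def)
  then have C: "C > 0" by (simp add: C_def)
  obtain n0 where n0: "n0 \<ge> 2" "real n0 \<ge> (16 * C) ^ d"
    using real_arch_simple[of "max 2 ((16 * C) ^ d)"] by auto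
  show thesis
  proof (rule that[of \<delta> n0])
    show "\<delta> > 0" using A C by (simp add: \<delta>_def)
    show "n0 \<ge> 2" by (rule n0(1))
    fix n h assume n: "n \<ge> n0" and h: "h = 1 / (2 * real d * \<alpha> * real n powr (1 / real d))"
    define r where "r = real n powr (1 / real d)"
    have r1: "r \<ge> 1" using n n0 by (simp add: r_def ge_one_powr_ge_zero)
    have rd: "r ^ d = real n"
      using n n0 assms(2) r1 by (simp add: r_def powr_realpow[symmetric] powr_powr)
    have "(16 * C) ^ d \<le> r ^ d" using n n0 rd by simp
    then have rC: "16 * C \<le> r"
      using power_strict_mono[of r "16 * C" d] r1 assms(2) by (force simp: not_less)
    have hr: "1 / h = A * r" by (simp add: h A_def r_def)
    have xh: "x / h = x * (A * r)" for x by (simp add: hr[symmetric])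
    have "2 / h + 2 = 2 * A * r + 2" "2 * \<delta> / h + 2 = 2 * A * \<delta> * r + 2"
      unfolding xh by simp_all
    then have "(2 / h + 2) ^ (d - 1) * (2 * \<delta> / h + 2) = (2 * A * r + 2) ^ (d - 1) * (2 * A * \<delta> * r + 2)"
      by simp
    also have "\<dots> \<le> ((2 * A + 2) * r) ^ (d - 1) * (2 * A * \<delta> * r + 2)"
      using A r1 \<open>\<delta> > 0\<close> by (intro mult_right_mono power_mono) (auto simp: algebra_simps)
    also have "\<dots> = C * r ^ (d - 1) * (2 * A * \<delta> * r + 2)" by (simp add: C_def power_mult_distrib)
    also have "\<dots> = C * 2 * A * \<delta> * (r ^ (d - 1) * r) + 2 * C * r ^ (d - 1)" by (simp add: algebra_simps)
    also have "r ^ (d - 1) * r = real n" using rd power_minus_mult[OF assms(2), of r] by simp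
    also have "C * 2 * A * \<delta> = 1 / 8" using A C by (simp add: \<delta>_def)
    also have "2 * C * r ^ (d - 1) \<le> (r / 8) * r ^ (d - 1)" using rC r1 by (intro mult_right_mono) auto
    also have "(r / 8) * r ^ (d - 1) = real n / 8"
      using rd power_minus_mult[OF assms(2), of r] by (simp add: mult.commute)
    finally show "(2 / h + 2) ^ (d - 1) * (2 * \<delta> / h + 2) \<le> real n / 4" by simp
  qed
qed

section \<open>Filling the determinant row by row\<close>

definition lift_point :: "real^'d \<Rightarrow> real^'d option" where
  "lift_point x = (\<chi> r. case r of None \<Rightarrow> 1 | Some k \<Rightarrow> x $ k)"

text \<open>Interpolates between the identity matrix and the (transposed) bordered matrix: the rows
  outside \<open>S\<close> are still unit vectors.\<close>

definition pdet :: "(nat \<Rightarrow> real^'d) \<Rightarrow> 'd set \<Rightarrow> ('d option \<Rightarrow> nat) \<Rightarrow> real" where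
  "pdet X S e = det (\<chi> c. case c of None \<Rightarrow> lift_point (X (e None))
     | Some k \<Rightarrow> if k \<in> S then lift_point (X (e (Some k))) else axis (Some k) 1)"

lemma det_row_linear:
  "det (\<chi> i. if i = k then v else C i) = (\<Sum>r\<in>UNIV. v $ r * det (\<chi> i. if i = k then axis r 1 else C i))"
  for v :: "real^'n"
proof -
  have "det (\<chi> i. if i = k then v else C i) = det (\<chi> i. if i = k then \<Sum>r\<in>UNIV. v $ r *s axis r 1 else C i)"
    by (simp only: basis_expansion)
  also have "\<dots> = (\<Sum>r\<in>UNIV. det (\<chi> i. if i = k then v $ r *s axis r 1 else C i))"
    by (rule det_linear_row_sum) simp
  finally show ?thesis by (simp add: det_row_mul)
qed

text \<open>Only row \<open>None\<close> differs from the identity matrix, and its diagonal entry is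
  1, so a row operation suffices.\<close>

lemma pdet_empty: "pdet X {} e = 1"
proof -
  let ?x = "X (e None)"
  let ?A = "mat 1 :: real^'a option^'a option"
  have row: "row c ?A = axis c 1" for c by (simp add: row_def mat_def axis_def vec_eq_iff eq_commute)
  have "(\<Sum>k\<in>UNIV. ?x $ k *s axis (Some k) 1) \<in> vec.span {row c ?A |c. c \<noteq> None}"
    by (intro vec.span_sum vec.span_scale vec.span_base) (auto simp: row)
  then have "det (\<chi> c. if c = None then row None ?A + (\<Sum>k\<in>UNIV. ?x $ k *s axis (Some k) 1) else row c ?A) = det ?A"
    by (rule det_row_span)
  moreover have "axis None 1 + (\<Sum>k\<in>UNIV. ?x $ k *s axis (Some k) 1) = lift_point ?x"
    by (auto simp: vec_eq_iff lift_point_def axis_def if_distrib split: option.split cong: if_cong)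
  moreover have "(\<chi> c. case c of None \<Rightarrow> lift_point ?x
      | Some k \<Rightarrow> if k \<in> {} then lift_point (X (e (Some k))) else axis (Some k) 1)
    = (\<chi> c. if c = None then lift_point ?x else axis c 1)"
    by (auto simp: vec_eq_iff split: option.split)
  ultimately show ?thesis by (simp only: pdet_def row det_I)
qed

lemma pdet_UNIV: "pdet X UNIV e = bdet (\<lambda>c. X (e c))"
proof -
  have "(\<chi> c. case c of None \<Rightarrow> lift_point (X (e None))
      | Some k \<Rightarrow> if k \<in> UNIV then lift_point (X (e (Some k))) else axis (Some k) 1)
    = transpose (border (\<lambda>c. X (e c)))"
    by (auto simp: vec_eq_iff transpose_def border_def lift_point_def split: option.split)
  then show ?thesis by (simp only: pdet_def bdet_def det_transpose)
qed

text \<open>The determinant is affine in the point of row \<open>Some k\<close>. With the unit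
  vector put back into that row it is the previous \<open>pdet\<close>, which is therefore one of
  the coefficients and a lower bound for the largest one.\<close>

lemma pdet_insert:
  fixes X :: "nat \<Rightarrow> real^'d"
  assumes "k \<notin> S" "pdet X S e \<noteq> 0"
  obtains a b j where "a $ j \<noteq> 0" "\<And>c. \<bar>a $ c\<bar> \<le> \<bar>a $ j\<bar>" "\<bar>pdet X S e\<bar> \<le> \<bar>a $ j\<bar>"
    "\<And>i. pdet X (insert k S) (e(Some k := i)) = a \<bullet> X i + b"
proof -
  define C where "C c = (case c of None \<Rightarrow> lift_point (X (e None))
     | Some k \<Rightarrow> if k \<in> S then lift_point (X (e (Some k))) else axis (Some k) 1)" for c
  define l where "l r = det (\<chi> c. if c = Some k then axis r 1 else C c)" for r
  define a where "a = (\<chi> c. l (Some c))"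
  have eq: "pdet X (insert k S) (e(Some k := i)) = a \<bullet> X i + l None" for i
  proof -
    have "pdet X (insert k S) (e(Some k := i)) = det (\<chi> c. if c = Some k then lift_point (X i) else C c)"
      unfolding pdet_def C_def by (intro arg_cong[of _ _ det]) (auto simp: vec_eq_iff split: option.split)
    also have "\<dots> = (\<Sum>r\<in>UNIV. lift_point (X i) $ r * l r)"
      unfolding l_def by (rule det_row_linear)
    finally show ?thesis
      by (simp add: sum_UNIV_option lift_point_def a_def inner_vec_def mult.commute)
  qed
  have "pdet X S e = l (Some k)"
    unfolding pdet_def l_def C_def using assms(1)
    by (intro arg_cong[of _ _ det]) (auto simp: vec_eq_iff split: option.split)
  then have ak: "pdet X S e = a $ k" by (simp add: a_def)
  have "\<exists>j. \<forall>c. \<bar>a $ c\<bar> \<le> \<bar>a $ j\<bar>"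
    using Max_in[of "range (\<lambda>c. \<bar>a $ c\<bar>)"] Max_ge[of "range (\<lambda>c. \<bar>a $ c\<bar>)"] by fastforce
  then obtain j where j: "\<And>c. \<bar>a $ c\<bar> \<le> \<bar>a $ j\<bar>" by blast
  show thesis
  proof (rule that[OF _ j _ eq])
    show "\<bar>pdet X S e\<bar> \<le> \<bar>a $ j\<bar>" using j[of k] ak by simp
    then show "a $ j \<noteq> 0" using assms(2) by auto
  qed
qed

text \<open>The width is relative to the largest coefficient, so avoiding a slab shrinks the
  determinant bound in \<open>pdet_insert\<close> by a factor of at most
  \<open>\<delta>\<close>.\<close>

definition slab_sparse :: "real \<Rightarrow> nat \<Rightarrow> (nat \<Rightarrow> real^'d) \<Rightarrow> bool" where
  "slab_sparse \<delta> n X \<longleftrightarrow> (\<forall>a b j. a $ j \<noteq> 0 \<longrightarrow> (\<forall>c. \<bar>a $ c\<bar> \<le> \<bar>a $ j\<bar>) \<longrightarrow>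
     real (card {i. i < n \<and> \<bar>a \<bullet> X i + b\<bar> < \<delta> * \<bar>a $ j\<bar>}) \<le> real n / 4)"

text \<open>The point of row \<open>None\<close> is free. Each further row excludes one slab for
  \<open>X\<close> and one for \<open>Y\<close>, which leaves at least n / 2 choices.\<close>

lemma card_fat_selections:
  fixes X Y :: "nat \<Rightarrow> real^'d"
  assumes "slab_sparse \<delta> n X" "slab_sparse \<delta> n Y" "\<delta> > 0"
  shows "real n * (real n / 2) ^ card S \<le> real (card {e \<in> insert None (Some ` S) \<rightarrow>\<^sub>E {..<n}.
    \<delta> ^ card S \<le> \<bar>pdet X S e\<bar> \<and> \<delta> ^ card S \<le> \<bar>pdet Y S e\<bar>})" (is "_ \<le> real (card (?G S))")
proof -
  have "finite S" by simp
  then show ?thesis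
  proof (induction S rule: finite_induct)
    case empty
    have "?G {} = ({None} \<rightarrow>\<^sub>E {..<n})" by (simp add: pdet_empty)
    then show ?case by (simp add: card_PiE)
  next
    case (insert k S)
    have finG: "finite (?G T)" for T
      by (rule finite_subset[of _ "insert None (Some ` T) \<rightarrow>\<^sub>E {..<n}"]) (auto intro!: finite_PiE)
    define N where "N e = {i. i < n \<and> \<delta> ^ card (insert k S) \<le> \<bar>pdet X (insert k S) (e(Some k := i))\<bar> \<and>
      \<delta> ^ card (insert k S) \<le> \<bar>pdet Y (insert k S) (e(Some k := i))\<bar>}" for e
    have bad: "real (card {i. i < n \<and> \<bar>pdet Z (insert k S) (e(Some k := i))\<bar> < \<delta> ^ card (insert k S)}) \<le> real n / 4"
      if Z: "slab_sparse \<delta> n Z" "\<delta> ^ card S \<le> \<bar>pdet Z S e\<bar>" for Z :: "nat \<Rightarrow> real^'d" and e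
    proof -
      have "0 < \<delta> ^ card S" using assms(3) by simp
      with Z(2) have "pdet Z S e \<noteq> 0" by auto
      then obtain a b j where ab: "a $ j \<noteq> 0" "\<And>c. \<bar>a $ c\<bar> \<le> \<bar>a $ j\<bar>" "\<bar>pdet Z S e\<bar> \<le> \<bar>a $ j\<bar>"
        "\<And>i. pdet Z (insert k S) (e(Some k := i)) = a \<bullet> Z i + b"
        by (rule pdet_insert[OF insert.hyps(2)]) (rule that)
      have "\<delta> ^ card (insert k S) \<le> \<delta> * \<bar>a $ j\<bar>"
        using Z(2) ab(3) assms(3) insert.hyps by simp
      then have "{i. i < n \<and> \<bar>pdet Z (insert k S) (e(Some k := i))\<bar> < \<delta> ^ card (insert k S)}
        \<subseteq> {i. i < n \<and> \<bar>a \<bullet> Z i + b\<bar> < \<delta> * \<bar>a $ j\<bar>}"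
        using ab(4) by auto
      then have "card {i. i < n \<and> \<bar>pdet Z (insert k S) (e(Some k := i))\<bar> < \<delta> ^ card (insert k S)}
        \<le> card {i. i < n \<and> \<bar>a \<bullet> Z i + b\<bar> < \<delta> * \<bar>a $ j\<bar>}" by (intro card_mono) auto
      also have "real \<dots> \<le> real n / 4" using Z(1) ab(1,2) unfolding slab_sparse_def by blast
      finally show ?thesis by simp
    qed
    have N: "real n / 2 \<le> real (card (N e))" if "e \<in> ?G S" for e
    proof -
      let ?X = "{i. i < n \<and> \<bar>pdet X (insert k S) (e(Some k := i))\<bar> < \<delta> ^ card (insert k S)}"
      let ?Y = "{i. i < n \<and> \<bar>pdet Y (insert k S) (e(Some k := i))\<bar> < \<delta> ^ card (insert k S)}"
      have "{..<n} = N e \<union> (?X \<union> ?Y)" unfolding N_def by force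
      then have "n \<le> card (N e) + card (?X \<union> ?Y)"
        using card_Un_le[of "N e" "?X \<union> ?Y"] by (metis card_lessThan)
      with card_Un_le[of ?X ?Y] have "real n \<le> real (card (N e)) + (real (card ?X) + real (card ?Y))" by linarith
      with bad[OF assms(1), of e] bad[OF assms(2), of e] that show ?thesis by simp
    qed
    have "real n * (real n / 2) ^ card (insert k S) = (real n * (real n / 2) ^ card S) * (real n / 2)"
      using insert.hyps by simp
    also have "\<dots> \<le> real (card (?G S)) * (real n / 2)"
      by (intro mult_right_mono insert.IH) simp
    also have "\<dots> = (\<Sum>e\<in>?G S. real n / 2)" by simp
    also have "\<dots> \<le> (\<Sum>e\<in>?G S. real (card (N e)))" by (intro sum_mono N)
    also have "\<dots> = real (card (Sigma (?G S) N))"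
      using finG by (subst card_SigmaI) (auto simp: N_def)
    also have "\<dots> \<le> real (card (?G (insert k S)))"
    proof -
      have "inj_on (\<lambda>(e, i). e(Some k := i)) (Sigma (?G S) N)"
      proof (rule inj_onI)
        fix u v assume uv: "u \<in> Sigma (?G S) N" "v \<in> Sigma (?G S) N"
          "(case u of (e, i) \<Rightarrow> e(Some k := i)) = (case v of (e, i) \<Rightarrow> e(Some k := i))"
        obtain e i e' i' where u: "u = (e, i)" and v: "v = (e', i')" by (cases u, cases v)
        have e: "e \<in> insert None (Some ` S) \<rightarrow>\<^sub>E {..<n}" "e' \<in> insert None (Some ` S) \<rightarrow>\<^sub>E {..<n}"
          using uv(1,2) unfolding u v mem_Sigma_iff mem_Collect_eq by iprover+
        have eq: "e(Some k := i) = e'(Some k := i')" using uv(3) by (simp only: u v case_prod_conv)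
        have "e c = e' c" for c
        proof (cases "c = Some k")
          \<comment> \<open>Both selections are extensional and \<open>Some k\<close> lies outside
            their domain, so the overwritten value is the same default.\<close>
          case True
          then have c: "c \<notin> insert None (Some ` S)" using insert.hyps by auto
          show ?thesis by (simp only: PiE_arb[OF e(1) c] PiE_arb[OF e(2) c])
        qed (use fun_cong[OF eq, of c] in simp)
        moreover have "i = i'" using fun_cong[OF eq, of "Some k"] by simp
        ultimately show "u = v" by (simp add: u v fun_eq_iff)
      qed
      moreover have "(\<lambda>(e, i). e(Some k := i)) ` Sigma (?G S) N \<subseteq> ?G (insert k S)"
      proof (rule image_subsetI)
        fix u assume uG: "u \<in> Sigma (?G S) N"
        obtain e i where u: "u = (e, i)" by (cases u)
        have e: "e \<in> insert None (Some ` S) \<rightarrow>\<^sub>E {..<n}" and i: "i \<in> N e"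
          using uG unfolding u mem_Sigma_iff mem_Collect_eq by iprover+
        have "e(Some k := i) \<in> insert (Some k) (insert None (Some ` S)) \<rightarrow>\<^sub>E {..<n}"
          using i by (intro PiE_fun_upd e) (simp add: N_def)
        moreover have "insert (Some k) (insert None (Some ` S)) = insert None (Some ` insert k S)" by auto
        ultimately have "e(Some k := i) \<in> insert None (Some ` insert k S) \<rightarrow>\<^sub>E {..<n}" by simp
        then show "(case u of (e, i) \<Rightarrow> e(Some k := i)) \<in> ?G (insert k S)"
          using i unfolding u case_prod_conv N_def mem_Collect_eq by iprover
      qed
      ultimately have "card (Sigma (?G S) N) \<le> card (?G (insert k S))" by (rule card_inj_on_le[OF _ _ finG])
      then show ?thesis by (simp only: of_nat_le_iff)
    qed
    finally show ?case .
  qed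
qed

lemma choose_le_power: "n choose k \<le> n ^ k"
  using binomial_le_pow[of k n] by (cases "k \<le> n") (simp_all add: binomial_eq_0)

text \<open>A selection with nonzero determinant is injective and so has an index set as its range.
  An index set arises from at most \<open>(d + 1) ^ (d + 1)\<close> selections, counting all maps
  into it.\<close>

lemma card_fat_index_sets:
  fixes X Y :: "nat \<Rightarrow> real^'d::{finite,linorder}"
  assumes "slab_sparse \<delta> n X" "slab_sparse \<delta> n Y" "\<delta> > 0"
  shows "real (n choose (CARD('d) + 1)) / (2 ^ CARD('d) * real (CARD('d) + 1) ^ (CARD('d) + 1))
    \<le> real (card {I \<in> index_sets CARD('d) n. \<delta> ^ CARD('d) \<le> \<bar>tdet I X\<bar> \<and> \<delta> ^ CARD('d) \<le> \<bar>tdet I Y\<bar>})"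
    (is "_ \<le> real (card ?F)")
proof -
  let ?d = "CARD('d)"
  let ?G = "{e \<in> (UNIV :: 'd option set) \<rightarrow>\<^sub>E {..<n}. \<delta> ^ ?d \<le> \<bar>pdet X UNIV e\<bar> \<and> \<delta> ^ ?d \<le> \<bar>pdet Y UNIV e\<bar>}"
  have U: "insert None (Some ` UNIV) = (UNIV :: 'd option set)" by (simp add: UNIV_option_conv)
  have leG: "real n * (real n / 2) ^ ?d \<le> real (card ?G)"
    using card_fat_selections[OF assms, of UNIV] unfolding U by simp
  have "?G \<subseteq> (\<Union>I\<in>?F. (UNIV :: 'd option set) \<rightarrow>\<^sub>E I)"
  proof
    fix e assume e: "e \<in> ?G"
    have "0 < \<delta> ^ ?d" using assms(3) by simp
    then have "bdet (\<lambda>c. X (e c)) \<noteq> 0" using e by (auto simp: pdet_UNIV)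
    have inj: "inj e"
    proof (rule injI, rule ccontr)
      fix c c' assume c: "e c = e c'" "c \<noteq> c'"
      have "column c (border (\<lambda>c. X (e c))) = column c' (border (\<lambda>c. X (e c)))"
        by (simp add: column_def border_def vec_eq_iff c(1) split: option.split)
      then have "bdet (\<lambda>c. X (e c)) = 0" unfolding bdet_def by (rule det_identical_columns[OF c(2)])
      with \<open>bdet _ \<noteq> 0\<close> show False by simp
    qed
    have I: "range e \<in> index_sets ?d n"
      using e card_image[OF inj] by (auto simp: index_sets_def)
    have bij: "bij_betw e UNIV (range e)" using inj by (simp add: bij_betw_def)
    from bdet_eq_tdet[OF I bij] obtain s where "s \<in> {1, -1}"
        "\<forall>X :: nat \<Rightarrow> real^'d::{finite,linorder}. bdet (\<lambda>c. X (e c)) = s * tdet (range e) X" by (rule bexE)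
    then have s: "s \<in> {1, -1}" "\<And>X :: nat \<Rightarrow> real^'d::{finite,linorder}. bdet (\<lambda>c. X (e c)) = s * tdet (range e) X"
      by simp_all
    have "\<bar>pdet Z UNIV e\<bar> = \<bar>tdet (range e) Z\<bar>" for Z :: "nat \<Rightarrow> real^'d::{finite,linorder}"
      using s(1) unfolding pdet_UNIV s(2) by (auto simp: abs_mult)
    with e I have "range e \<in> ?F" by auto
    then show "e \<in> (\<Union>I\<in>?F. (UNIV :: 'd option set) \<rightarrow>\<^sub>E I)" by auto
  qed
  then have "card ?G \<le> card (\<Union>I\<in>?F. (UNIV :: 'd option set) \<rightarrow>\<^sub>E I)"
    by (intro card_mono finite_UN_I finite_PiE) (auto dest: index_setsD(1))
  also have "\<dots> \<le> (\<Sum>I\<in>?F. card ((UNIV :: 'd option set) \<rightarrow>\<^sub>E I))"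
    by (rule card_UN_le) simp
  also have "\<dots> = (\<Sum>I\<in>?F. (?d + 1) ^ (?d + 1))"
    by (intro sum.cong refl) (auto simp: card_PiE dest: index_setsD(2))
  finally have "card ?G \<le> card ?F * (?d + 1) ^ (?d + 1)" by simp
  then have "real (card ?G) \<le> real (card ?F * (?d + 1) ^ (?d + 1))" by (simp only: of_nat_le_iff)
  with leG have le: "real n * (real n / 2) ^ ?d \<le> real (card ?F) * real (?d + 1) ^ (?d + 1)"
    by (simp only: of_nat_mult of_nat_power)
  have "n choose (?d + 1) \<le> n ^ (?d + 1)" by (rule choose_le_power)
  then have "real (n choose (?d + 1)) \<le> real n ^ (?d + 1)" by (simp only: of_nat_power[symmetric] of_nat_le_iff)
  also have "\<dots> = real n * (real n / 2) ^ ?d * 2 ^ ?d" by (simp add: power_divide)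
  also have "\<dots> \<le> real (card ?F) * real (?d + 1) ^ (?d + 1) * 2 ^ ?d" by (intro mult_right_mono le) simp
  finally have "real (n choose (?d + 1)) \<le> real (card ?F) * (2 ^ ?d * real (?d + 1) ^ (?d + 1))"
    by (simp only: mult_ac)
  moreover have "0 < 2 ^ ?d * real (?d + 1) ^ (?d + 1)" by (intro mult_pos_pos zero_less_power) simp_all
  ultimately show ?thesis by (simp only: pos_divide_le_eq)
qed

subsection \<open>The gain from nonreal roots\<close>

lemma exists_complex_structure:
  assumes "even CARD('d::finite)"
  shows "\<exists>J :: real^'d \<Rightarrow> real^'d. linear J \<and> (\<forall>v. J (J v) = - v)"
proof -
  let ?d = "CARD('d)"
  obtain h :: "nat \<Rightarrow> 'd" where h: "bij_betw h {0..<?d} UNIV"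
    using ex_bij_betw_nat_finite[of "UNIV :: 'd set"] by auto
  define g where "g = inv_into {0..<?d} h"
  have hg: "h (g k) = k" for k unfolding g_def by (rule bij_betw_inv_into_right[OF h]) simp
  have gh: "g (h m) = m" if "m < ?d" for m
    unfolding g_def using that by (intro bij_betw_inv_into_left[OF h]) simp
  have gd: "g k < ?d" for k
    using bij_betw_apply[OF bij_betw_inv_into[OF h], of k] by (simp add: g_def)
  \<comment> \<open>Coordinates are numbered from 0 and paired as 2m and 2m + 1. Since d is even,
    every even number below d has its successor below d.\<close>
  define J :: "real^'d \<Rightarrow> real^'d" where
    "J v = (\<chi> k. if even (g k) then v $ h (g k + 1) else - v $ h (g k - 1))" for v
  have "linear J"
    by (rule linearI) (simp_all add: J_def vec_eq_iff)
  moreover have "J (J v) $ k = - v $ k" for v k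
  proof (cases "even (g k)")
    case True
    then have "odd (g k + 1)" by simp
    then have "g k + 1 \<noteq> ?d" using assms by metis
    then have "g k + 1 < ?d" using gd[of k] by linarith
    then show ?thesis using True gh[of "g k + 1"] by (simp add: J_def hg)
  next
    case False
    then have "g k \<noteq> 0" by (intro notI) simp
    then show ?thesis using False gh[of "g k - 1"] gd[of k] by (simp add: J_def hg)
  qed
  ultimately show ?thesis by (intro exI[of _ J]) (simp add: vec_eq_iff)
qed

text \<open>For each witness \<open>z\<close> the condition is a strict inequality between
  continuous functions; the union over all \<open>z\<close> stays open.\<close>

lemma open_has_nonreal_root:
  fixes f g :: "'b::topological_space \<Rightarrow> 'd::finite option \<Rightarrow> real^'d"
  assumes "\<And>c. continuous_on UNIV (\<lambda>p. f p c)" "\<And>c. continuous_on UNIV (\<lambda>p. g p c)"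
  shows "open {p. has_nonreal_root (f p) (g p)}"
proof -
  have "open {p. cmod (cpencil (f p) (g p) z) < \<bar>bdet (g p)\<bar> * \<bar>Im z\<bar> ^ CARD('d)}" for z
    unfolding cpencil_def by (intro open_Collect_less continuous_intros assms)
  then have "open (\<Union>z. {p. cmod (cpencil (f p) (g p) z) < \<bar>bdet (g p)\<bar> * \<bar>Im z\<bar> ^ CARD('d)})"
    by (intro open_UN ballI)
  moreover have "(\<Union>z. {p. cmod (cpencil (f p) (g p) z) < \<bar>bdet (g p)\<bar> * \<bar>Im z\<bar> ^ CARD('d)})
    = {p. has_nonreal_root (f p) (g p)}"
    by (auto simp: has_nonreal_root_def)
  ultimately show ?thesis by simp
qed

text \<open>The closed condition with \<open>\<epsilon>\<close> keeps the determinants away from 0,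
  so the pairs form a compact set, on which the sets of pairs served by a fixed angle are an open
  cover.\<close>

lemma finite_rotations_suffice:
  fixes J :: "real^'d \<Rightarrow> real^'d"
  assumes d: "CARD('d) mod 4 = 2" and J: "linear J" "\<And>v. J (J v) = - v" and "\<epsilon> > 0"
  obtains \<Theta> where "finite \<Theta>" "\<And>x y :: 'd option \<Rightarrow> real^'d. (\<And>c. norm (x c) \<le> 1) \<Longrightarrow> (\<And>c. norm (y c) \<le> 1) \<Longrightarrow>
    \<epsilon> \<le> bdet x * bdet y \<Longrightarrow> \<exists>\<theta>\<in>\<Theta>. has_nonreal_root x (\<lambda>c. rot J \<theta> (y c))"
proof -
  let ?T = "{p. \<epsilon> \<le> bdet (\<lambda>c. fst p $ c) * bdet (\<lambda>c. snd p $ c)} :: (((real^'d)^'d option) \<times> ((real^'d)^'d option)) set"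
  define B where "B = {X :: (real^'d)^'d option. \<forall>c. norm (X $ c) \<le> 1}"
  have cB: "compact B"
  proof -
    have "norm X \<le> real CARD('d option)" if "X \<in> B" for X
    proof -
      have "norm X \<le> (\<Sum>c\<in>UNIV. norm (X $ c))" unfolding norm_vec_def by (rule L2_set_le_sum) simp
      also have "\<dots> \<le> (\<Sum>c\<in>(UNIV :: 'd option set). 1)" using that by (intro sum_mono) (simp add: B_def)
      finally show ?thesis by simp
    qed
    then have "bounded B" by (rule boundedI)
    moreover have "closed B"
      unfolding B_def by (intro closed_Collect_all closed_Collect_le continuous_intros)
    ultimately show ?thesis by (simp add: compact_eq_bounded_closed)
  qed
  have "closed ?T" by (intro closed_Collect_le continuous_intros)
  then have cK: "compact ((B \<times> B) \<inter> ?T)" using cB by (intro compact_Int_closed compact_Times)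
  define U where "U \<theta> = {p :: ((real^'d)^'d option) \<times> ((real^'d)^'d option).
    has_nonreal_root (\<lambda>c. fst p $ c) (\<lambda>c. rot J \<theta> (snd p $ c))}" for \<theta>
  have rotc: "continuous_on UNIV (rot J \<theta>)" for \<theta>
    using linear_rot[OF J(1)] by (simp add: linear_continuous_on linear_conv_bounded_linear)
  have "continuous_on UNIV (\<lambda>p :: ((real^'d)^'d option) \<times> ((real^'d)^'d option). rot J \<theta> (snd p $ c))" for \<theta> c
    by (rule continuous_on_compose2[OF rotc]) (auto intro!: continuous_intros)
  then have "open (U \<theta>)" for \<theta>
    unfolding U_def by (intro open_has_nonreal_root continuous_intros)
  moreover have "(B \<times> B) \<inter> ?T \<subseteq> (\<Union>\<theta>\<in>UNIV. U \<theta>)"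
  proof
    fix p assume "p \<in> (B \<times> B) \<inter> ?T"
    then have "0 < bdet (\<lambda>c. fst p $ c) * bdet (\<lambda>c. snd p $ c)" using \<open>\<epsilon> > 0\<close> by auto
    from exists_rot_has_nonreal_root[OF d J this] show "p \<in> (\<Union>\<theta>\<in>UNIV. U \<theta>)" by (simp add: U_def)
  qed
  ultimately obtain \<Theta> where \<Theta>: "finite \<Theta>" "(B \<times> B) \<inter> ?T \<subseteq> (\<Union>\<theta>\<in>\<Theta>. U \<theta>)"
    by (rule compactE_image[OF cK]) auto
  have eta: "($) (vec_lambda x) = x" for x :: "'d option \<Rightarrow> real^'d" by (rule ext) simp
  show thesis
  proof (rule that[OF \<Theta>(1)])
    fix x y :: "'d option \<Rightarrow> real^'d"
    assume xy: "\<And>c. norm (x c) \<le> 1" "\<And>c. norm (y c) \<le> 1" "\<epsilon> \<le> bdet x * bdet y"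
    then have "((\<chi> c. x c), (\<chi> c. y c)) \<in> (B \<times> B) \<inter> ?T" by (simp add: B_def eta)
    with \<Theta>(2) have "((\<chi> c. x c), (\<chi> c. y c)) \<in> (\<Union>\<theta>\<in>\<Theta>. U \<theta>)" by (rule subsetD)
    then show "\<exists>\<theta>\<in>\<Theta>. has_nonreal_root x (\<lambda>c. rot J \<theta> (y c))" by (simp add: U_def eta)
  qed
qed

section \<open>Free motions and pairs of opposite targets\<close>

lemma general_position_affine_image:
  fixes X :: "nat \<Rightarrow> real^'d" and L :: "real^'d \<Rightarrow> real^'d"
  assumes "linear L" "inj L" "general_position n X"
  shows "general_position n (\<lambda>i. w + L (X i))"
  unfolding general_position_def
proof
  fix I assume I: "I \<in> index_sets CARD('d) n"
  have eq: "(\<lambda>i. w + L (X i)) ` I = (\<lambda>x. w + L x) ` (X ` I)" by (simp only: image_image)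
  have "\<not> on_common_hyperplane (X ` I)" using assms(3) I unfolding general_position_def by (rule bspec)
  then show "\<not> on_common_hyperplane ((\<lambda>i. w + L (X i)) ` I)"
    unfolding eq by (rule contrapos_nn) (rule on_common_hyperplane_affine_image[OF assms(1,2)])
qed

lemma free_motion_rot:
  fixes J :: "real^'d \<Rightarrow> real^'d"
  assumes J: "linear J" "\<And>v. J (J v) = - v" and "general_position n Y"
  shows "free_motion n Y (\<lambda>i. rot J \<theta> (Y i))"
  unfolding free_motion_def
proof (intro exI[of _ "\<lambda>t i. rot J (t * \<theta>) (Y i)"] conjI allI impI ballI)
  show "continuous_on {0..1} (\<lambda>t. rot J (t * \<theta>) (Y i))" for i
    unfolding rot_def by (intro continuous_intros)
  show "general_position n (\<lambda>i. rot J (t * \<theta>) (Y i))" for t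
    using general_position_affine_image[OF linear_rot[OF J(1)] inj_rot[OF J] assms(3), of 0] by simp
qed simp_all

text \<open>After division by the largest distance the ratio bound becomes a lower bound on all
  distances; moving \<open>P 0\<close> to the origin bounds the norms.\<close>

lemma normalisation:
  fixes P :: "nat \<Rightarrow> real^'d"
  assumes "non_elongated \<alpha> n P" "n \<ge> 2" "general_position n P" "\<alpha> > 0"
  obtains X where "free_motion n P X" "\<And>i. i < n \<Longrightarrow> norm (X i) \<le> 1"
    "\<And>i j. i < n \<Longrightarrow> j < n \<Longrightarrow> i \<noteq> j \<Longrightarrow> 1 / (\<alpha> * real n powr (1 / real CARD('d))) \<le> dist (X i) (X j)"
proof -
  let ?S = "pairwise_dists n P" and ?r = "\<alpha> * real n powr (1 / real CARD('d))"
  define D where "D = Max ?S"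
  \<comment> \<open>A positive scale going linearly from 1 to \<open>1 / D\<close>; together with
    the translation it keeps the whole path in general position.\<close>
  define s where "s t = 1 - t + t / D" for t :: real
  have inj: "inj_on P {..<n}" and ratio: "Max ?S / Min ?S \<le> ?r"
    using assms(1,2) by (auto simp: non_elongated_def)
  have "?S \<subseteq> (\<lambda>(i, j). dist (P i) (P j)) ` ({..<n} \<times> {..<n})" by (auto simp: pairwise_dists_def)
  then have fin: "finite ?S" by (rule finite_subset) simp
  have mem: "dist (P i) (P j) \<in> ?S" if "i < n" "j < n" "i \<noteq> j" for i j
    using that by (auto simp: pairwise_dists_def)
  have ne: "?S \<noteq> {}" using mem[of 0 1] assms(2) by auto
  have pos: "x > 0" if "x \<in> ?S" for x
    using that inj by (auto simp: pairwise_dists_def inj_on_def)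
  have D: "D > 0" "Min ?S > 0" using pos Max_in[OF fin ne] Min_in[OF fin ne] by (auto simp: D_def)
  have r: "?r > 0" using assms(2,4) by simp
  have D_le: "D \<le> ?r * Min ?S" using ratio D by (simp add: D_def field_simps)
  have s: "s t > 0" if "t \<in> {0..1}" for t
  proof (cases "t = 0")
    case False
    then have "t / D > 0" using that D by simp
    then show ?thesis using that unfolding s_def by auto
  qed (simp add: s_def)
  show thesis
  proof (rule that[of "\<lambda>i. (1 / D) *\<^sub>R (P i - P 0)"])
    show "free_motion n P (\<lambda>i. (1 / D) *\<^sub>R (P i - P 0))"
      unfolding free_motion_def
    proof (intro exI[of _ "\<lambda>t i. s t *\<^sub>R (P i - t *\<^sub>R P 0)"] conjI allI impI ballI)
      show "continuous_on {0..1} (\<lambda>t. s t *\<^sub>R (P i - t *\<^sub>R P 0))" for i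
        unfolding s_def by (intro continuous_intros) (use D in auto)
      show "general_position n (\<lambda>i. s t *\<^sub>R (P i - t *\<^sub>R P 0))" if t: "t \<in> {0..1}" for t
      proof -
        have "inj ((*\<^sub>R) (s t) :: real^'d \<Rightarrow> real^'d)" using s[OF t] by (auto simp: inj_def)
        from general_position_affine_image[OF linear_scaleR this assms(3), of "- (s t * t) *\<^sub>R P 0"]
        show ?thesis by (simp add: scaleR_diff_right)
      qed
    qed (simp_all add: s_def)
    fix i assume i: "i < n"
    show "norm ((1 / D) *\<^sub>R (P i - P 0)) \<le> 1"
    proof (cases "i = 0")
      case False
      then have "dist (P i) (P 0) \<le> D" unfolding D_def using i by (intro Max_ge fin mem) auto
      then show ?thesis using D by (simp add: dist_norm)
    qed simp
    fix j assume j: "j < n" "i \<noteq> j"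
    have "D \<le> ?r * dist (P i) (P j)"
      using D_le r Min_le[OF fin mem[OF i j]] by (meson mult_left_mono order_trans less_imp_le)
    then have "1 / ?r \<le> dist (P i) (P j) / D" using D(1) r by (simp only: divide_le_eq) (simp add: field_simps)
    moreover have "dist ((1 / D) *\<^sub>R (P i - P 0)) ((1 / D) *\<^sub>R (P j - P 0)) = dist (P i) (P j) / D"
      using D by (simp add: dist_norm scaleR_diff_right[symmetric])
    ultimately show "1 / ?r \<le> dist ((1 / D) *\<^sub>R (P i - P 0)) ((1 / D) *\<^sub>R (P j - P 0))"
      by simp
  qed
qed

text \<open>\<open>Q\<close> is close enough to \<open>Y\<close> for the segment between them to be
  free and for the certificates in \<open>N\<close> to persist, and generic enough for both segments
  from \<open>P\<close> to be motions. Each member of \<open>N\<close> loses at least one of the d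
  possible roots.\<close>

lemma opposite_motions:
  fixes P Y :: "nat \<Rightarrow> real^'d::{finite,linorder}" and n :: nat
  defines "N \<equiv> {I \<in> index_sets CARD('d) n. has_nonreal_root (\<lambda>c. P (idx I c)) (\<lambda>c. Y (idx I c))}"
  assumes P: "general_position n P" and Y: "general_position n Y"
  obtains Q m m' where "free_motion n Y Q" "free_motion n (\<lambda>i. - Y i) (\<lambda>i. - Q i)"
    "is_motion n P Q m" "is_motion n P (\<lambda>i. - Q i) m'"
    "card (degenerate_times n m) + card (degenerate_times n m') + card N
      \<le> CARD('d) * (n choose (CARD('d) + 1))"
proof -
  let ?S = "index_sets CARD('d) n"
  \<comment> \<open>The product over all index sets expresses general position along the whole
    segment as nonvanishing of one function.\<close>
  define V where "V = {Q. \<forall>t\<in>{0..1}. (\<Prod>I\<in>?S. tdet I (seg Y Q t)) \<noteq> 0}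
    \<inter> (\<Inter>I\<in>N. {Q. has_nonreal_root (\<lambda>c. P (idx I c)) (\<lambda>c. Q (idx I c))})"
  have finN: "finite N" by (simp add: N_def)
  have coord: "continuous_on UNIV (\<lambda>Q :: nat \<Rightarrow> real^'d::{finite,linorder}. Q i)" for i
    by (rule continuous_on_coordinate[OF continuous_on_id])
  have coord': "continuous_on UNIV (\<lambda>p :: (nat \<Rightarrow> real^'d::{finite,linorder}) \<times> real. fst p i)" for i
    by (rule continuous_on_coordinate[OF continuous_on_fst[OF continuous_on_id]])
  have "continuous_on UNIV (\<lambda>(Q, t). \<Prod>I\<in>?S. tdet I (seg Y Q t))"
    unfolding case_prod_beta
    by (intro continuous_on_prod continuous_on_tdet continuous_on_seg continuous_on_snd continuous_on_id coord')
  then have "open {Q. \<forall>t\<in>{0..1::real}. (\<Prod>I\<in>?S. tdet I (seg Y Q t)) \<noteq> 0}"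
    by (intro open_Collect_ball_nonzero) simp_all
  moreover have "open {Q. has_nonreal_root (\<lambda>c. P (idx I c)) (\<lambda>c. Q (idx I c))}" for I
    by (intro open_has_nonreal_root continuous_on_const coord)
  ultimately have oV: "open V" unfolding V_def using finN by (intro open_Int open_INT ballI)
  have "Y \<in> V"
  proof -
    have "seg Y Y t = Y" for t by (simp add: seg_def fun_eq_iff scaleR_left_distrib[symmetric])
    then show ?thesis using Y by (simp add: V_def N_def general_position_iff_tdet)
  qed
  then have neV: "V \<noteq> {}" by auto
  from generic_target[OF P oV neV] obtain Q where QV: "Q \<in> V" and Q: "\<forall>I\<in>?S. \<forall>J\<in>?S. I \<noteq> J \<longrightarrow> (\<forall>t\<in>{0..1}.
     \<not> (tdet I (seg P Q t) = 0 \<and> tdet J (seg P Q t) = 0) \<and>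
     \<not> (tdet I (seg P (\<lambda>i. - Q i) t) = 0 \<and> tdet J (seg P (\<lambda>i. - Q i) t) = 0))"
    by (rule bexE)
  have gp: "general_position n (seg Y Q t)" if "t \<in> {0..1}" for t
    using QV that by (auto simp: V_def general_position_iff_tdet)
  have "seg Y Q 1 = Q" by (simp add: seg_def fun_eq_iff)
  with gp[of 1] have gpQ: "general_position n Q" by simp
  have minus: "general_position n (\<lambda>i. - X i)" if "general_position n X" for X :: "nat \<Rightarrow> real^'d::{finite,linorder}"
    using general_position_affine_image[OF _ _ that, of uminus 0] by (simp add: linear_uminus)
  show thesis
  proof (rule that)
    show "free_motion n Y Q"
      unfolding free_motion_def
      by (intro exI[of _ "seg Y Q"] conjI allI impI ballI gp continuous_on_seg continuous_on_id continuous_on_const)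
        (simp_all add: seg_def)
    show "free_motion n (\<lambda>i. - Y i) (\<lambda>i. - Q i)"
      unfolding free_motion_def
      by (intro exI[of _ "\<lambda>t i. - seg Y Q t i"] conjI allI impI ballI minus gp
          continuous_on_minus continuous_on_seg continuous_on_id continuous_on_const)
        (simp_all add: seg_def)
    show "is_motion n P Q (seg P Q)" by (rule is_motion_seg(1)[OF P]) (use Q in blast)
    show "is_motion n P (\<lambda>i. - Q i) (seg P (\<lambda>i. - Q i))" by (rule is_motion_seg(1)[OF P]) (use Q in blast)
    let ?A = "\<lambda>I. card {t\<in>{0..1}. tdet I (seg P Q t) = 0}"
    let ?B = "\<lambda>I. card {t\<in>{0..1}. tdet I (seg P (\<lambda>i. - Q i) t) = 0}"
    have A: "card (degenerate_times n (seg P Q)) \<le> sum ?A ?S"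
      by (rule is_motion_seg(2)[OF P]) (use Q in blast)
    have B: "card (degenerate_times n (seg P (\<lambda>i. - Q i))) \<le> sum ?B ?S"
      by (rule is_motion_seg(2)[OF P]) (use Q in blast)
    have "?A I + ?B I + (if I \<in> N then 1 else 0) \<le> CARD('d)" if I: "I \<in> ?S" for I
    proof -
      have nz: "tdet I P \<noteq> 0" "tdet I Q \<noteq> 0" using P gpQ I by (simp_all add: general_position_iff_tdet)
      have "has_nonreal_root (\<lambda>c. P (idx I c)) (\<lambda>c. Q (idx I c))" if "I \<in> N"
        using QV that by (simp add: V_def)
      then show ?thesis
        using card_seg_roots[OF nz] real_roots_tdet(2,3)[OF nz(1), of Q] by (cases "I \<in> N") force+
    qed
    then have "(\<Sum>I\<in>?S. ?A I + ?B I + (if I \<in> N then 1 else 0)) \<le> (\<Sum>I\<in>?S. CARD('d))" by (rule sum_mono)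
    moreover have "(\<Sum>I\<in>?S. if I \<in> N then 1 else 0) = card N"
    proof -
      have "?S \<inter> N = N" by (auto simp: N_def)
      then show ?thesis by (simp add: sum.If_cases)
    qed
    ultimately have "sum ?A ?S + sum ?B ?S + card N \<le> card ?S * CARD('d)"
      by (simp add: sum.distrib)
    with A B show "card (degenerate_times n (seg P Q)) + card (degenerate_times n (seg P (\<lambda>i. - Q i))) + card N
      \<le> CARD('d) * (n choose (CARD('d) + 1))"
      by (simp add: card_index_sets mult.commute)
  qed
qed

text \<open>The cheaper of the two opposite motions costs at most half of their sum.\<close>

lemma motion_dist_le_half:
  fixes P P' X Y :: "nat \<Rightarrow> real^'d::{finite,linorder}"
  assumes J: "linear J" "\<And>v. J (J v) = - v"
    and free: "free_motion n P X" "free_motion n P' Y" and gp: "general_position n X" "general_position n Y"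
  shows "\<exists>k. motion_dist n P P' \<le> enat k \<and>
    2 * k + card {I \<in> index_sets CARD('d) n. has_nonreal_root (\<lambda>c. X (idx I c)) (\<lambda>c. rot J \<theta> (Y (idx I c)))}
      \<le> CARD('d) * (n choose (CARD('d) + 1))"
proof -
  let ?N = "{I \<in> index_sets CARD('d) n. has_nonreal_root (\<lambda>c. X (idx I c)) (\<lambda>c. rot J \<theta> (Y (idx I c)))}"
  have rot: "general_position n (\<lambda>i. rot J \<theta> (Y i))"
    using general_position_affine_image[OF linear_rot[OF J(1)] inj_rot[OF J] gp(2), of 0] by simp
  obtain Q m m' where Q: "free_motion n (\<lambda>i. rot J \<theta> (Y i)) Q" "free_motion n (\<lambda>i. - rot J \<theta> (Y i)) (\<lambda>i. - Q i)"
    "is_motion n X Q m" "is_motion n X (\<lambda>i. - Q i) m'"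
    "card (degenerate_times n m) + card (degenerate_times n m') + card ?N
      \<le> CARD('d) * (n choose (CARD('d) + 1))"
    by (rule opposite_motions[OF gp(1) rot])
  have "free_motion n P' Q"
    using free_motion_trans[OF free(2) free_motion_trans[OF free_motion_rot[OF J gp(2)] Q(1)]] .
  then have le: "motion_dist n P P' \<le> enat (card (degenerate_times n m))"
    by (rule motion_dist_free_le[OF free(1) Q(3)])
  \<comment> \<open>Rotating on by pi negates the tuple, so the opposite target is reached at no
    cost as well.\<close>
  have "free_motion n Y (\<lambda>i. - rot J \<theta> (Y i))"
    using free_motion_rot[OF J gp(2), of "\<theta> + pi"] by simp
  then have "free_motion n P' (\<lambda>i. - Q i)"
    using free_motion_trans[OF free(2)] free_motion_trans[OF _ Q(2)] by blast
  then have le': "motion_dist n P P' \<le> enat (card (degenerate_times n m'))"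
    by (rule motion_dist_free_le[OF free(1) Q(4)])
  show ?thesis
  proof (intro exI[of _ "min (card (degenerate_times n m)) (card (degenerate_times n m'))"] conjI)
    show "motion_dist n P P' \<le> enat (min (card (degenerate_times n m)) (card (degenerate_times n m')))"
      using le le' by (simp add: min_def)
  qed (use Q(5) in simp)
qed

lemma free_motion_refl: "general_position n P \<Longrightarrow> free_motion n P P"
  unfolding free_motion_def by (intro exI[of _ "\<lambda>t. P"]) simp

lemma free_motion_general_position:
  fixes P Q :: "nat \<Rightarrow> real^'d::{finite,linorder}"
  assumes "free_motion n P Q" shows "general_position n Q"
proof -
  obtain m :: "real \<Rightarrow> nat \<Rightarrow> real^'d::{finite,linorder}" where m: "\<And>i. i < n \<Longrightarrow> m 1 i = Q i"
      "\<And>t. t \<in> {0..1} \<Longrightarrow> general_position n (m t)"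
    using free_motionE[OF assms] by metis
  show ?thesis using m(2)[of 1] general_position_cong[of n "m 1" Q] m(1) by simp
qed

theorem theorem3:
  fixes \<alpha> :: real
  assumes "CARD('d::{finite,linorder}) mod 4 = 2" and "\<alpha> > 0"
  shows "\<exists>\<beta>>0. \<forall>n. \<forall>(P :: nat \<Rightarrow> real ^ 'd::{finite,linorder}) P' :: nat \<Rightarrow> real ^ 'd::{finite,linorder}.
           non_elongated \<alpha> n P \<and> non_elongated \<alpha> n P' \<and>
           general_position n P \<and> general_position n P' \<and>
           order_type n P = order_type n P' \<longrightarrow>
           ereal_of_enat (motion_dist n P P')
             \<le> ereal ((real CARD('d) / 2 - \<beta>) * real (n choose (CARD('d) + 1)))"
proof -
  let ?d = "CARD('d)"
  have "even ?d" using assms(1) by presburger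
  then obtain J :: "real^'d::{finite,linorder} \<Rightarrow> real^'d::{finite,linorder}" where J: "linear J" "\<And>v. J (J v) = - v"
    using exists_complex_structure by blast
  have d0: "?d > 0" by simp
  obtain \<delta> n0 where \<delta>: "\<delta> > 0" "n0 \<ge> 2" and slab: "\<And>n h. n \<ge> n0 \<Longrightarrow>
      h = 1 / (2 * real ?d * \<alpha> * real n powr (1 / real ?d)) \<Longrightarrow>
      (2 / h + 2) ^ (?d - 1) * (2 * \<delta> / h + 2) \<le> real n / 4"
    using slab_parameters[OF assms(2) d0] by metis
  have \<epsilon>: "\<delta> ^ ?d * \<delta> ^ ?d > 0" using \<delta>(1) by simp
  obtain \<Theta> where \<Theta>: "finite \<Theta>" "\<And>x y :: 'd option \<Rightarrow> real^'d::{finite,linorder}. (\<And>c. norm (x c) \<le> 1) \<Longrightarrow> (\<And>c. norm (y c) \<le> 1) \<Longrightarrow>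
    \<delta> ^ ?d * \<delta> ^ ?d \<le> bdet x * bdet y \<Longrightarrow> \<exists>\<theta>\<in>\<Theta>. has_nonreal_root x (\<lambda>c. rot J \<theta> (y c))"
    using finite_rotations_suffice[OF assms(1) J \<epsilon>] by metis
  \<comment> \<open>At least the fraction \<open>1 / M\<close> of the index sets is fat in both
    tuples, by \<open>card_fat_index_sets\<close>.\<close>
  define M where "M = 2 ^ ?d * real (?d + 1) ^ (?d + 1)"
  \<comment> \<open>The first entry is what the best of the angles in \<open>\<Theta>\<close>
    achieves for large \<open>n\<close>, the second is one tuple out of at most
    \<open>n0 ^ (d + 1)\<close>. The \<open>+ 1\<close> keeps the first entry positive for empty
    \<open>\<Theta>\<close> and makes the averaging strict.\<close>
  define \<gamma> where "\<gamma> = min (1 / (M * real (card \<Theta> + 1))) (1 / real n0 ^ (?d + 1))"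
  have M: "M > 0" unfolding M_def by (intro mult_pos_pos zero_less_power) simp_all
  have \<gamma>0: "\<gamma> > 0" using M \<delta>(2) by (simp add: \<gamma>_def)
  have key: "\<exists>k. motion_dist n P P' \<le> enat k \<and>
      2 * real k + \<gamma> * real (n choose (?d + 1)) \<le> real ?d * real (n choose (?d + 1))"
    if ne: "non_elongated \<alpha> n P" "non_elongated \<alpha> n P'" and gp: "general_position n P" "general_position n P'"
      and ot: "order_type n P = order_type n P'" for n and P P' :: "nat \<Rightarrow> real^'d::{finite,linorder}"
  proof -
    let ?S = "index_sets ?d n" and ?C = "real (n choose (?d + 1))"
    define N where "N X Y \<theta> = {I \<in> ?S. has_nonreal_root (\<lambda>c. X (idx I c)) (\<lambda>c. rot J \<theta> (Y (idx I c)))}"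
      for X Y :: "nat \<Rightarrow> real^'d::{finite,linorder}" and \<theta>
    have suff: ?thesis if fr: "free_motion n P X" "free_motion n P' Y" "\<gamma> * ?C \<le> real (card (N X Y \<theta>))" for X Y \<theta>
    proof -
      from motion_dist_le_half[OF J fr(1,2) free_motion_general_position[OF fr(1)]
          free_motion_general_position[OF fr(2)], of \<theta>]
      obtain k where k: "motion_dist n P P' \<le> enat k" "2 * k + card (N X Y \<theta>) \<le> ?d * (n choose (?d + 1))"
        unfolding N_def by (elim exE conjE)
      from k(2) have "real (2 * k + card (N X Y \<theta>)) \<le> real (?d * (n choose (?d + 1)))" by (simp only: of_nat_le_iff)
      then have "2 * real k + \<gamma> * ?C \<le> real ?d * ?C" using fr(3) by (simp only: of_nat_add of_nat_mult of_nat_numeral)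
      with k(1) show ?thesis by blast
    qed
    have same: "0 < tdet I X * tdet I Y" if "free_motion n P X" "free_motion n P' Y" "I \<in> ?S" for X Y I
    proof -
      have "sgn (tdet I X) = sgn (tdet I Y)"
        using order_type_eqD[OF ot that(3)] free_motion_sgn_tdet[OF that(1,3)] free_motion_sgn_tdet[OF that(2,3)] by simp
      moreover have "tdet I X \<noteq> 0"
        using free_motion_general_position[OF that(1)] that(3) by (simp add: general_position_iff_tdet)
      ultimately show ?thesis by (auto simp: sgn_if zero_less_mult_iff split: if_splits)
    qed
    show ?thesis
    proof (cases "n \<ge> n0")
      case False
      show ?thesis
      proof (cases "?S = {}")
        case True
        then have "n choose (?d + 1) = 0" using card_index_sets[of ?d n] by simp
        then have "\<gamma> * ?C \<le> real (card (N P P' 0))" by (simp only: of_nat_0 mult_zero_right of_nat_0_le_iff)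
        then show ?thesis by (rule suff[OF free_motion_refl[OF gp(1)] free_motion_refl[OF gp(2)]])
      next
        case nonempty: False
        \<comment> \<open>For small \<open>n\<close> an angle adapted to a single tuple gains 1,
          which is enough for this choice of \<open>\<gamma>\<close>.\<close>
        then obtain I where I: "I \<in> ?S" by blast
        have "0 < bdet (\<lambda>c. P (idx I c)) * bdet (\<lambda>c. P' (idx I c))"
          using same[OF free_motion_refl[OF gp(1)] free_motion_refl[OF gp(2)] I] by (simp add: tdet_def)
        from exists_rot_has_nonreal_root[OF assms(1) J this]
        obtain \<theta> where "has_nonreal_root (\<lambda>c. P (idx I c)) (\<lambda>c. rot J \<theta> (P' (idx I c)))"
          by (rule exE)
        with I have "I \<in> N P P' \<theta>" by (simp add: N_def)
        then have "card (N P P' \<theta>) \<noteq> 0" by (auto simp: N_def)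
        then have 1: "1 \<le> real (card (N P P' \<theta>))" by linarith
        have "n choose (?d + 1) \<le> n ^ (?d + 1)" by (rule choose_le_power)
        also have "\<dots> \<le> n0 ^ (?d + 1)" using False by (intro power_mono) auto
        finally have "?C \<le> real n0 ^ (?d + 1)" by (simp only: of_nat_power[symmetric] of_nat_le_iff)
        then have "1 / real n0 ^ (?d + 1) * ?C \<le> 1" using \<delta>(2) by (simp add: field_simps)
        moreover have "\<gamma> * ?C \<le> 1 / real n0 ^ (?d + 1) * ?C" unfolding \<gamma>_def by (intro mult_right_mono) auto
        ultimately show ?thesis using 1 by (intro suff[OF free_motion_refl[OF gp(1)] free_motion_refl[OF gp(2)], of \<theta>]) linarith
      qed
    next
      case True
      then have n2: "n \<ge> 2" using \<delta>(2) by simp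
      obtain X where X: "free_motion n P X" "\<And>i. i < n \<Longrightarrow> norm (X i) \<le> 1"
        "\<And>i j. i < n \<Longrightarrow> j < n \<Longrightarrow> i \<noteq> j \<Longrightarrow> 1 / (\<alpha> * real n powr (1 / real ?d)) \<le> dist (X i) (X j)"
        by (rule normalisation[OF ne(1) n2 gp(1) assms(2)]) (rule that)
      obtain Y where Y: "free_motion n P' Y" "\<And>i. i < n \<Longrightarrow> norm (Y i) \<le> 1"
        "\<And>i j. i < n \<Longrightarrow> j < n \<Longrightarrow> i \<noteq> j \<Longrightarrow> 1 / (\<alpha> * real n powr (1 / real ?d)) \<le> dist (Y i) (Y j)"
        by (rule normalisation[OF ne(2) n2 gp(2) assms(2)]) (rule that)
      have sparse: "slab_sparse \<delta> n Z" if Z: "\<And>i. i < n \<Longrightarrow> norm (Z i) \<le> 1"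
        "\<And>i j. i < n \<Longrightarrow> j < n \<Longrightarrow> i \<noteq> j \<Longrightarrow> 1 / (\<alpha> * real n powr (1 / real ?d)) \<le> dist (Z i) (Z j)"
        for Z :: "nat \<Rightarrow> real^'d::{finite,linorder}"
        unfolding slab_sparse_def
      proof (intro allI impI)
        fix a :: "real^'d::{finite,linorder}" and b j assume a: "a $ j \<noteq> 0" "\<forall>c. \<bar>a $ c\<bar> \<le> \<bar>a $ j\<bar>"
        let ?h = "1 / (2 * real ?d * \<alpha> * real n powr (1 / real ?d))"
        have h: "?h > 0" using assms(2) n2 by simp
        have "2 * real ?d * ?h = 1 / (\<alpha> * real n powr (1 / real ?d))" by simp
        then have "real (card {i. i < n \<and> \<bar>a \<bullet> Z i + b\<bar> < \<delta> * \<bar>a $ j\<bar>})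
          \<le> (2 / ?h + 2) ^ (?d - 1) * (2 * \<delta> / ?h + 2)"
          using Z a by (intro card_slab_le[OF _ _ _ _ h \<delta>(1)]) simp_all
        also have "\<dots> \<le> real n / 4" by (rule slab[OF True refl])
        finally show "real (card {i. i < n \<and> \<bar>a \<bullet> Z i + b\<bar> < \<delta> * \<bar>a $ j\<bar>}) \<le> real n / 4" .
      qed
      define F where "F = {I \<in> ?S. \<delta> ^ ?d \<le> \<bar>tdet I X\<bar> \<and> \<delta> ^ ?d \<le> \<bar>tdet I Y\<bar>}"
      have F: "?C / M \<le> real (card F)"
        unfolding M_def F_def
        by (rule card_fat_index_sets[OF sparse[OF X(2,3)] sparse[OF Y(2,3)] \<delta>(1)])
      have finN: "finite (N X Y \<theta>)" for \<theta> by (simp add: N_def)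
      have "F \<subseteq> (\<Union>\<theta>\<in>\<Theta>. N X Y \<theta>)"
      proof
        fix I assume I: "I \<in> F"
        then have IS: "I \<in> ?S" by (simp add: F_def)
        \<comment> \<open>Equal orientations make the product of the two determinants positive, so
          fatness in both tuples meets the threshold for which \<open>\<Theta>\<close> was
          chosen.\<close>
        have "\<delta> ^ ?d * \<delta> ^ ?d \<le> \<bar>tdet I X\<bar> * \<bar>tdet I Y\<bar>"
          using I \<delta>(1) by (intro mult_mono) (auto simp: F_def)
        also have "\<dots> = tdet I X * tdet I Y"
          using same[OF X(1) Y(1) IS] by (simp add: abs_mult[symmetric])
        finally have "\<exists>\<theta>\<in>\<Theta>. has_nonreal_root (\<lambda>c. X (idx I c)) (\<lambda>c. rot J \<theta> (Y (idx I c)))"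
          using IS by (intro \<Theta>(2) X(2) Y(2) idx_less) (simp_all add: tdet_def)
        with IS show "I \<in> (\<Union>\<theta>\<in>\<Theta>. N X Y \<theta>)" by (simp add: N_def)
      qed
      then have "card F \<le> card (\<Union>\<theta>\<in>\<Theta>. N X Y \<theta>)" using \<Theta>(1) finN by (intro card_mono) auto
      also have "\<dots> \<le> (\<Sum>\<theta>\<in>\<Theta>. card (N X Y \<theta>))" by (rule card_UN_le[OF \<Theta>(1)])
      finally have F_le: "real (card F) \<le> (\<Sum>\<theta>\<in>\<Theta>. real (card (N X Y \<theta>)))"
        by (simp only: of_nat_sum[symmetric] of_nat_le_iff)
      have "\<exists>\<theta>. \<gamma> * ?C \<le> real (card (N X Y \<theta>))"
      proof (rule ccontr)
        assume "\<not> ?thesis"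
        then have less: "real (card (N X Y \<theta>)) < \<gamma> * ?C" for \<theta> by (simp add: not_le)
        have "?C / M \<le> (\<Sum>\<theta>\<in>\<Theta>. \<gamma> * ?C)"
          using F F_le less by (meson order_trans sum_mono less_imp_le)
        then have "?C / M \<le> real (card \<Theta>) * (\<gamma> * ?C)" by simp
        \<comment> \<open>Strict because \<open>less\<close> bounds a cardinality from above by
          \<open>\<gamma> * ?C\<close>, which is therefore positive.\<close>
        also have "\<dots> < (real (card \<Theta>) + 1) * (\<gamma> * ?C)"
          using less[of 0] by (simp add: algebra_simps)
        also have "\<dots> \<le> (real (card \<Theta>) + 1) * (1 / (M * real (card \<Theta> + 1)) * ?C)"
          unfolding \<gamma>_def by (intro mult_left_mono mult_right_mono) auto
        also have "\<dots> = ?C / M"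
        proof -
          have "q * (1 / (M * q) * c) = c / M" if "q > 0" for q c :: real
            using that M by (simp add: field_simps)
          from this[of "real (card \<Theta>) + 1" ?C] show ?thesis by (simp add: add.commute)
        qed
        finally show False by simp
      qed
      then obtain \<theta> where "\<gamma> * ?C \<le> real (card (N X Y \<theta>))" ..
      then show ?thesis by (rule suff[OF X(1) Y(1)])
    qed
  qed
  show ?thesis
  \<comment> \<open>The bound in \<open>key\<close> is on twice the cost, hence half of
    \<open>\<gamma>\<close>.\<close>
  proof (intro exI[of _ "\<gamma> / 2"] conjI allI impI)
    show "\<gamma> / 2 > 0" using \<gamma>0 by simp
    fix n and P P' :: "nat \<Rightarrow> real^'d::{finite,linorder}"
    assume "non_elongated \<alpha> n P \<and> non_elongated \<alpha> n P' \<and> general_position n P \<and> general_position n P' \<and>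
           order_type n P = order_type n P'"
    then obtain k where k: "motion_dist n P P' \<le> enat k"
      "2 * real k + \<gamma> * real (n choose (?d + 1)) \<le> real ?d * real (n choose (?d + 1))"
      using key by metis
    have "ereal_of_enat (motion_dist n P P') \<le> ereal_of_enat (enat k)"
      using k(1) by (simp only: ereal_of_enat_le_iff)
    also have "\<dots> = ereal (real k)" by simp
    also have "\<dots> \<le> ereal ((real ?d / 2 - \<gamma> / 2) * real (n choose (?d + 1)))"
      using k(2) by (simp add: algebra_simps)
    finally show "ereal_of_enat (motion_dist n P P') \<le> ereal ((real ?d / 2 - \<gamma> / 2) * real (n choose (?d + 1)))" .
  qed
qed

end
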